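(* For all open sets $\Omega,\Omega'\subseteq\mathbb{R}^d$, every $T\in\mathcal{D}'(\Omega)$ and every $C^\infty$-diffeomorphism $\psi:\Omega'\to\Omega$ we have $(E_\Omega(T)\circ\psi\,|\,\tau)=(E_{\Omega'}(T\circ\psi)\,|\,\tau)$ for all $\tau\in\mathcal{D}(\Omega')$.
   Context: $T\circ\psi\in\mathcal{D}'(\Omega')$ is the composition (pullback) of a distribution with a diffeomorphism in the sense of distribution theory. Fix $\mathcal{D}_0=\mathcal{D}(\mathbb{R}^d)$. For $\varphi\in\mathcal{D}_0$ let $R_\varphi=\sup\{\|x\|:\varphi(x)\neq0\}$ if $\varphi\neq0$, $R_0=1$. For $n\in\mathbb{N}$, $\mathcal{D}_n$ is the set of $\varphi\in\mathcal{D}_0$ that are real-valued, even, with $R_\varphi\le1/n$, $\int\varphi=1$, $\int x^\alpha\varphi(x)dx=0$ for $1\le|\alpha|\le n$, $\int|\varphi|\le1+1/n$, and $\sup_x|\partial^\alpha\varphi(x)|\le R_\varphi^{-2(|\alpha|+d)}$ for $|\alpha|\le n$. $\mathcal{U}$ is a fixed free ultrafilter on $\mathcal{D}_0$ containing every $\mathcal{D}_n$ (and $\mathfrak c^+$-good); "$P(\varphi)$ a.e." means $\{\varphi:P(\varphi)\}\in\mathcal{U}$. $\widehat{\mathbb{C}^{\mathcal{D}_0}}$: nets $(A_\varphi)\in\mathbb{C}^{\mathcal{D}_0}$ with $|A_\varphi|\le R_\varphi^{-m}$ a.e. for some $m$, modulo nets with $|A_\varphi|<R_\varphi^p$ a.e.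 for all $p$. For open $\Omega$, $\widehat{\mathcal{E}(\Omega)^{\mathcal{D}_0}}$: nets $(f_\varphi)$ in $C^\infty(\Omega)$ such that for all compact $K\subset\Omega$ and $\alpha\in\mathbb{N}_0^d$ there is $m$ with $\sup_K|\partial^\alpha f_\varphi|\le R_\varphi^{-m}$ a.e., modulo nets with $\sup_K|\partial^\alpha f_\varphi|\le R_\varphi^p$ a.e. for all $K,\alpha,p$. Pairing: $(\widehat{f_\varphi}|\tau)=$ class of $(\int f_\varphi\tau)_\varphi$. Composition: $\widehat{f_\varphi}\circ\psi=\widehat{f_\varphi\circ\psi}$. $E_\Omega(T)=\widehat{T\circledast\varphi}$, where $(T\circledast\varphi)(x)=(T(t)\,|\,C_{\Omega,\varphi}(t)\varphi(x-t))$, $C_{\Omega,\varphi}(x)=\int_{\widetilde\Omega_\varphi}\varphi(x-t)\,dt$, $\widetilde\Omega_\varphi=\{x\in\Omega:d(x,\partial\Omega)>2R_\varphi,\ \|x\|<1/R_\varphi\}$. *)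

theory Defs
  imports "HOL-Analysis.Analysis"
begin

primrec iterpd :: "(real^'n) list \<Rightarrow> (real^'n \<Rightarrow> 'b::real_normed_vector) \<Rightarrow> real^'n \<Rightarrow> 'b" where
  "iterpd [] f = f"
| "iterpd (b # bs) f = (\<lambda>x. frechet_derivative (iterpd bs f) (at x) b)"

definition smooth_on :: "(real^'n) set \<Rightarrow> (real^'n \<Rightarrow> 'b::real_normed_vector) \<Rightarrow> bool" where
  "smooth_on U f \<longleftrightarrow> (\<forall>bs. set bs \<subseteq> Basis \<longrightarrow> (\<forall>x\<in>U. iterpd bs f differentiable (at x)))"

definition axes_list :: "('n::finite \<Rightarrow> nat) \<Rightarrow> (real^'n) list" where
  "axes_list \<alpha> = (SOME bs. (\<forall>i. count_list bs (axis i (1::real)) = \<alpha> i) \<and>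
                            set bs \<subseteq> range (\<lambda>i. axis i (1::real)))"

definition mderiv :: "('n::finite \<Rightarrow> nat) \<Rightarrow> (real^'n \<Rightarrow> 'b::real_normed_vector) \<Rightarrow> real^'n \<Rightarrow> 'b" where
  "mderiv \<alpha> f = iterpd (axes_list \<alpha>) f"

definition mabs :: "('n::finite \<Rightarrow> nat) \<Rightarrow> nat" where
  "mabs \<alpha> = (\<Sum>i\<in>UNIV. \<alpha> i)"

definition tsupport :: "(real^'n \<Rightarrow> complex) \<Rightarrow> (real^'n) set" where
  "tsupport \<phi> = closure {x. \<phi> x \<noteq> 0}"

text \<open>Test functions D(Omega): smooth, compact support contained in Omega
  (extended by zero to the whole space).\<close>
definition test_fun :: "(real^'n) set \<Rightarrow> (real^'n \<Rightarrow> complex) \<Rightarrow> bool" where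
  "test_fun \<Omega> \<phi> \<longleftrightarrow> smooth_on UNIV \<phi> \<and> compact (tsupport \<phi>) \<and> tsupport \<phi> \<subseteq> \<Omega>"

definition supnorm :: "(real^'n \<Rightarrow> complex) \<Rightarrow> real" where
  "supnorm f = Sup (range (\<lambda>x. norm (f x)))"

definition distribution :: "(real^'n::finite) set \<Rightarrow> ((real^'n \<Rightarrow> complex) \<Rightarrow> complex) \<Rightarrow> bool" where
  "distribution \<Omega> T \<longleftrightarrow>
     (\<forall>\<phi> \<eta>. test_fun \<Omega> \<phi> \<longrightarrow> test_fun \<Omega> \<eta> \<longrightarrow> T (\<lambda>x. \<phi> x + \<eta> x) = T \<phi> + T \<eta>) \<and>
     (\<forall>c \<phi>. test_fun \<Omega> \<phi> \<longrightarrow> T (\<lambda>x. c * \<phi> x) = c * T \<phi>) \<and>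
     (\<forall>K. compact K \<longrightarrow> K \<subseteq> \<Omega> \<longrightarrow>
        (\<exists>C m. \<forall>\<phi>. test_fun \<Omega> \<phi> \<longrightarrow> tsupport \<phi> \<subseteq> K \<longrightarrow>
            norm (T \<phi>) \<le> C * (\<Sum>\<alpha>\<in>{\<alpha>. mabs \<alpha> \<le> m}. supnorm (mderiv \<alpha> \<phi>))))"

definition diffeo :: "(real^'n) set \<Rightarrow> (real^'n) set \<Rightarrow> (real^'n \<Rightarrow> real^'n) \<Rightarrow> bool" where
  "diffeo \<Omega>' \<Omega> \<psi> \<longleftrightarrow> bij_betw \<psi> \<Omega>' \<Omega> \<and> smooth_on \<Omega>' \<psi> \<and> smooth_on \<Omega> (inv_into \<Omega>' \<psi>)"

definition pullback :: "(real^'n::finite) set \<Rightarrow> (real^'n \<Rightarrow> real^'n) \<Rightarrow>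
      ((real^'n \<Rightarrow> complex) \<Rightarrow> complex) \<Rightarrow> (real^'n \<Rightarrow> complex) \<Rightarrow> complex" where
  "pullback \<Omega>' \<psi> T \<tau> = T (\<lambda>y. if y \<in> \<psi> ` \<Omega>'
       then \<tau> (inv_into \<Omega>' \<psi> y) *
            complex_of_real \<bar>det (matrix (frechet_derivative (inv_into \<Omega>' \<psi>) (at y)))\<bar>
       else 0)"

definition Rphi :: "(real^'n \<Rightarrow> complex) \<Rightarrow> real" where
  "Rphi \<phi> = (if \<phi> = (\<lambda>_. 0) then 1 else Sup {norm x | x. \<phi> x \<noteq> 0})"

definition Dn :: "nat \<Rightarrow> (real^'n::finite \<Rightarrow> complex) set" where
  "Dn n = {\<phi>. test_fun UNIV \<phi> \<and>
     (\<forall>x. Im (\<phi> x) = 0) \<and>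
     (\<forall>x. \<phi> (- x) = \<phi> x) \<and>
     Rphi \<phi> \<le> 1 / real n \<and>
     integral UNIV \<phi> = 1 \<and>
     (\<forall>\<alpha>. 1 \<le> mabs \<alpha> \<and> mabs \<alpha> \<le> n \<longrightarrow>
        integral UNIV (\<lambda>x. complex_of_real (\<Prod>i\<in>UNIV. (x $ i) ^ \<alpha> i) * \<phi> x) = 0) \<and>
     integral UNIV (\<lambda>x. norm (\<phi> x)) \<le> 1 + 1 / real n \<and>
     (\<forall>\<alpha>. mabs \<alpha> \<le> n \<longrightarrow>
        (\<forall>x. norm (mderiv \<alpha> \<phi> x) \<le> Rphi \<phi> powr (- 2 * real (mabs \<alpha> + CARD('n)))))}"

definition D0 :: "(real^'n::finite \<Rightarrow> complex) set" where
  "D0 = {\<phi>. test_fun UNIV \<phi>}"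

definition ultrafilter_on :: "'a set \<Rightarrow> 'a set set \<Rightarrow> bool" where
  "ultrafilter_on X U \<longleftrightarrow> U \<subseteq> Pow X \<and> X \<in> U \<and> {} \<notin> U \<and>
     (\<forall>A B. A \<in> U \<longrightarrow> B \<in> U \<longrightarrow> A \<inter> B \<in> U) \<and>
     (\<forall>A B. A \<in> U \<longrightarrow> A \<subseteq> B \<longrightarrow> B \<subseteq> X \<longrightarrow> B \<in> U) \<and>
     (\<forall>A. A \<subseteq> X \<longrightarrow> A \<in> U \<or> X - A \<in> U)"

definition free_ultrafilter_on :: "'a set \<Rightarrow> 'a set set \<Rightarrow> bool" where
  "free_ultrafilter_on X U \<longleftrightarrow> ultrafilter_on X U \<and> \<Inter> U = {}"

text \<open>c^+-good: for every index set of cardinality at most continuum (realised as a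
  set of reals) every monotone decreasing map from its finite subsets into U has a
  multiplicative refinement in U (Keisler).\<close>
definition cplus_good :: "'a set set \<Rightarrow> bool" where
  "cplus_good U \<longleftrightarrow> (\<forall>(I::real set) f.
     (\<forall>s. finite s \<and> s \<subseteq> I \<longrightarrow> f s \<in> U) \<and>
     (\<forall>s t. finite t \<and> t \<subseteq> I \<and> s \<subseteq> t \<longrightarrow> f t \<subseteq> f s) \<longrightarrow>
     (\<exists>g. (\<forall>s. finite s \<and> s \<subseteq> I \<longrightarrow> g s \<in> U \<and> g s \<subseteq> f s) \<and>
          (\<forall>s t. finite s \<and> finite t \<and> s \<subseteq> I \<and> t \<subseteq> I \<longrightarrow> g (s \<union> t) = g s \<inter> g t)))"

definition admissible_ultrafilter :: "(real^'n::finite \<Rightarrow> complex) set set \<Rightarrow> bool" where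
  "admissible_ultrafilter U \<longleftrightarrow> free_ultrafilter_on D0 U \<and> (\<forall>n\<ge>1. Dn n \<in> U) \<and> cplus_good U"

definition ae_U :: "(real^'n::finite \<Rightarrow> complex) set set \<Rightarrow> ((real^'n \<Rightarrow> complex) \<Rightarrow> bool) \<Rightarrow> bool" where
  "ae_U U P \<longleftrightarrow> {\<phi> \<in> D0. P \<phi>} \<in> U"

text \<open>Negligible nets of complex numbers; two classes in the generalized numbers
  are equal iff the difference of representatives is negligible.\<close>
definition negligible_net :: "(real^'n::finite \<Rightarrow> complex) set set \<Rightarrow> ((real^'n \<Rightarrow> complex) \<Rightarrow> complex) \<Rightarrow> bool" where
  "negligible_net U A \<longleftrightarrow> (\<forall>p::nat. ae_U U (\<lambda>\<phi>. norm (A \<phi>) < Rphi \<phi> ^ p))"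

definition Omega_tilde :: "(real^'n) set \<Rightarrow> (real^'n \<Rightarrow> complex) \<Rightarrow> (real^'n) set" where
  "Omega_tilde \<Omega> \<phi> = {x \<in> \<Omega>. (frontier \<Omega> = {} \<or> 2 * Rphi \<phi> < infdist x (frontier \<Omega>)) \<and>
                             norm x < 1 / Rphi \<phi>}"

definition C_fun :: "(real^'n) set \<Rightarrow> (real^'n \<Rightarrow> complex) \<Rightarrow> real^'n \<Rightarrow> complex" where
  "C_fun \<Omega> \<phi> x = integral (Omega_tilde \<Omega> \<phi>) (\<lambda>t. \<phi> (x - t))"

text \<open>(T conv phi)(x) = (T(t) | C(t) phi(x - t)); the net (T conv phi)_phi represents E_Omega(T).\<close>
definition dconv :: "(real^'n) set \<Rightarrow> ((real^'n \<Rightarrow> complex) \<Rightarrow> complex) \<Rightarrow> (real^'n \<Rightarrow> complex) \<Rightarrow> real^'n \<Rightarrow> complex" where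
  "dconv \<Omega> T \<phi> x = T (\<lambda>t. C_fun \<Omega> \<phi> t * \<phi> (x - t))"

end

theory Submission
  imports Defs
begin

text \<open>Write \<open>\<theta>\<close> for the inverse of \<open>\<psi>\<close> and \<open>\<sigma> = (\<tau> \<circ> \<theta>) \<bar>det \<theta>'\<bar>\<close>, so that \<open>(T \<circ> \<psi> | \<tau>) = (T | \<sigma>)\<close>.
  After the substitution \<open>y = \<psi> x\<close> both pairings have the form \<open>\<integral> (S \<circledast> \<phi>) \<sigma>\<close> with \<open>S\<close> a distribution and
  \<open>\<sigma>\<close> a test function, and it suffices that this differs negligibly from \<open>(S | \<sigma>)\<close>.
  For small \<open>R\<^sub>\<phi>\<close> the cut-off \<open>C\<close> equals 1 near the support of \<open>\<sigma>\<close>, so pulling the integral into \<open>S\<close>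
  gives \<open>(S | \<phi> * \<sigma>)\<close>. By Taylor's formula and the vanishing moments of \<open>\<phi>\<close>, every derivative of
  \<open>\<phi> * \<sigma> - \<sigma>\<close> is \<open>O(R\<^sub>\<phi>\<^sup>p)\<close> uniformly, for each \<open>p\<close>, and continuity of \<open>S\<close> concludes.\<close>

subsection \<open>Calculus of smooth functions\<close>

text \<open>Two obstacles shape the argument. The first is that \<open>T\<close> is controlled only
  on genuine test functions while \<open>dconv\<close> contains the cut-off \<open>C_fun\<close>. So
  \<open>dconv\<close> is examined only at points \<open>x\<close> of the support of \<sigma>, where
  \<open>C_fun \<Omega> \<phi> t * \<phi> (x - t)\<close> is, as a function of \<open>t\<close>,
  literally \<open>\<phi> (t - x)\<close>; evenness of \<phi> turns the argument round. At all other
  \<open>x\<close> the factor \<open>\<sigma> x\<close> is zero. The second is that pulling the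
  integral into the distribution leaves \<phi> as the factor depending on \<open>t\<close>, while
  the estimate wants the derivatives on the fixed \<sigma>, since those of \<phi> may grow like
  negative powers of the radius. Commutativity of the convolution reconciles the two. Constants
  depending on \<open>T\<close> and \<sigma> are absorbed by expanding to order
  \<open>p + 1\<close>: a multiple of \<open>R ^ (p + 1)\<close> is below \<open>R ^ p / 2\<close>
  once \<open>R\<close> is small. Each estimate is proved for every \<phi> in \<open>Dn n\<close>
  with \<open>n\<close> large, where \<open>n\<close> may depend on \<open>p\<close>; since
  \<open>Dn n\<close> belongs to the ultrafilter, this is what "a.e." asks for.\<close>

abbreviation pd :: "real^'n \<Rightarrow> (real^'n \<Rightarrow> 'b::real_normed_vector) \<Rightarrow> real^'n \<Rightarrow> 'b" where
  "pd b f \<equiv> \<lambda>x. frechet_derivative f (at x) b"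

lemma frechet_derivative_cong_open:
  assumes "open U" "x \<in> U" "\<And>y. y \<in> U \<Longrightarrow> f y = g y"
  shows "frechet_derivative f (at x) = frechet_derivative g (at x)"
proof -
  have "(f has_derivative D) (at x) \<longleftrightarrow> (g has_derivative D) (at x)" for D
    using has_derivative_transform_within_open[OF _ assms(1,2), of f D UNIV g]
      has_derivative_transform_within_open[OF _ assms(1,2), of g D UNIV f] assms(3) by auto
  then show ?thesis by (simp add: frechet_derivative_def)
qed

lemma differentiable_cong_open:
  assumes "open U" "x \<in> U" "\<And>y. y \<in> U \<Longrightarrow> f y = g y" "g differentiable at x"
  shows "f differentiable at x"
  using assms has_derivative_transform_within_open[OF _ assms(1,2), of g _ UNIV f]
  unfolding differentiable_def by metis

lemma iterpd_append: "iterpd (bs @ cs) f = iterpd bs (iterpd cs f)"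
  by (induction bs) simp_all

lemma iterpd_cong_open:
  assumes "open U" "\<And>x. x \<in> U \<Longrightarrow> f x = g x" "x \<in> U"
  shows "iterpd bs f x = iterpd bs g x"
  using \<open>x \<in> U\<close>
proof (induction bs arbitrary: x)
  case (Cons b bs)
  then show ?case
    using frechet_derivative_cong_open[OF \<open>open U\<close> Cons.prems Cons.IH] by simp
qed (use assms in simp)

lemma smooth_on_differentiable:
  "smooth_on U f \<Longrightarrow> x \<in> U \<Longrightarrow> f differentiable at x"
  unfolding smooth_on_def by (metis iterpd.simps(1) empty_set empty_subsetI)

lemma smooth_on_iterpd:
  assumes "smooth_on U f" "set cs \<subseteq> Basis"
  shows "smooth_on U (iterpd cs f)"
  using assms unfolding smooth_on_def iterpd_append[symmetric] by auto

lemma smooth_on_pd: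
  "smooth_on U f \<Longrightarrow> b \<in> Basis \<Longrightarrow> smooth_on U (pd b f)"
  using smooth_on_iterpd[of U f "[b]"] by simp

lemma smooth_on_continuous:
  assumes "smooth_on U f"
  shows "continuous_on U f"
  by (metis assms smooth_on_differentiable continuous_at_imp_continuous_on differentiable_imp_continuous_within)

lemma smooth_on_subset: "smooth_on U f \<Longrightarrow> V \<subseteq> U \<Longrightarrow> smooth_on V f"
  unfolding smooth_on_def by blast

lemma smooth_on_Un: "smooth_on U f \<Longrightarrow> smooth_on V f \<Longrightarrow> smooth_on (U \<union> V) f"
  unfolding smooth_on_def by blast

lemma smooth_on_cong:
  assumes "smooth_on U g" "open U" "\<And>x. x \<in> U \<Longrightarrow> f x = g x"
  shows "smooth_on U f"
  unfolding smooth_on_def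
proof (intro allI impI ballI)
  fix bs :: "(real^'a) list" and x assume "set bs \<subseteq> Basis" "x \<in> U"
  then show "iterpd bs f differentiable at x"
    using assms iterpd_cong_open[OF assms(2,3)] unfolding smooth_on_def
    by (intro differentiable_cong_open[OF assms(2), of x "iterpd bs f" "iterpd bs g"]) auto
qed

text \<open>An invariant that implies differentiability and is stable under partial derivatives
  captures all iterated derivatives. Stability is asked only up to equality on \<open>U\<close>:
  \<open>frechet_derivative\<close> has unspecified values where a function is not differentiable,
  and on an open set derivatives see only the values there.\<close>

lemma smooth_on_coinduct:
  assumes "open U" "P f"
    and step: "\<And>f. P f \<Longrightarrow> (\<forall>x\<in>U. f differentiable at x) \<and>
      (\<forall>b\<in>Basis. \<exists>g. P g \<and> (\<forall>x\<in>U. pd b f x = g x))"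
  shows "smooth_on U f"
proof -
  have *: "\<exists>g. P g \<and> (\<forall>x\<in>U. iterpd bs f x = g x)" if "set bs \<subseteq> Basis" for bs
    using that
  proof (induction bs)
    case Nil
    then show ?case using \<open>P f\<close> by auto
  next
    case (Cons b bs)
    then obtain g where g: "P g" "\<And>x. x \<in> U \<Longrightarrow> iterpd bs f x = g x" by auto
    obtain h where h: "P h" "\<And>x. x \<in> U \<Longrightarrow> pd b g x = h x"
      using step[OF g(1)] Cons.prems by auto
    have "iterpd (b # bs) f x = h x" if "x \<in> U" for x
      using frechet_derivative_cong_open[OF \<open>open U\<close> that g(2)] h(2)[OF that] by simp
    then show ?case using h(1) by blast
  qed
  show ?thesis
    unfolding smooth_on_def
  proof (intro allI impI ballI)
    fix bs :: "(real^'a) list" and x assume "set bs \<subseteq> Basis" "x \<in> U"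
    with * obtain g where "P g" "\<And>x. x \<in> U \<Longrightarrow> iterpd bs f x = g x" by blast
    then show "iterpd bs f differentiable at x"
      using step \<open>x \<in> U\<close> differentiable_cong_open[OF \<open>open U\<close>] by metis
  qed
qed

lemma pd_unique: "(f has_derivative D) (at x) \<Longrightarrow> pd b f x = D b"
  using frechet_derivative_at by metis

lemma differentiable_has_pd:
  "f differentiable at x \<Longrightarrow> (f has_derivative (\<lambda>h. frechet_derivative f (at x) h)) (at x)"
  by (simp add: frechet_derivative_works)

lemma smooth_on_const: "open U \<Longrightarrow> smooth_on U (\<lambda>_. c)"
  by (rule smooth_on_coinduct[where P="\<lambda>f. \<exists>c. f = (\<lambda>_. c)"]) auto

lemma pd_bounded_linear:
  assumes "bounded_linear L" "f differentiable at x"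
  shows "(\<lambda>x. L (f x)) differentiable at x" "pd b (\<lambda>x. L (f x)) x = L (pd b f x)"
  using bounded_linear.has_derivative[OF assms(1) differentiable_has_pd[OF assms(2)]]
  by (auto simp: differentiable_def pd_unique)

lemma smooth_on_bounded_linear:
  assumes "bounded_linear L" "open U" "smooth_on U f"
  shows "smooth_on U (\<lambda>x. L (f x))"
proof (rule smooth_on_coinduct[where P="\<lambda>g. \<exists>f. smooth_on U f \<and> g = (\<lambda>x. L (f x))"])
  fix g assume "\<exists>f. smooth_on U f \<and> g = (\<lambda>x. L (f x))"
  then obtain f where f: "smooth_on U f" "g = (\<lambda>x. L (f x))" by blast
  show "(\<forall>x\<in>U. g differentiable at x) \<and>
    (\<forall>b\<in>Basis. \<exists>h. (\<exists>f. smooth_on U f \<and> h = (\<lambda>x. L (f x))) \<and> (\<forall>x\<in>U. pd b g x = h x))"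
    unfolding f(2)
    using pd_bounded_linear[OF assms(1)] smooth_on_differentiable[OF f(1)] smooth_on_pd[OF f(1)]
    by blast
qed (use assms in auto)

lemma iterpd_bounded_linear:
  assumes "bounded_linear L" "open U" "smooth_on U f" "set bs \<subseteq> Basis" "x \<in> U"
  shows "iterpd bs (\<lambda>x. L (f x)) x = L (iterpd bs f x)"
  using assms(4,5)
proof (induction bs arbitrary: x)
  case (Cons b bs)
  have "iterpd bs f differentiable at x"
    using assms(3) Cons.prems unfolding smooth_on_def by simp
  from pd_bounded_linear(2)[OF assms(1) this, of b]
  show ?case using frechet_derivative_cong_open[OF assms(2) Cons.prems(2) Cons.IH] Cons.prems by simp
qed simp

text \<open>Products and compositions of smooth functions are not closed under partial
  derivatives individually, but this joint class is; that makes it a coinduction invariant.\<close>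
inductive sclass :: "(real^'n) set \<Rightarrow> (real^'m) set \<Rightarrow> (real^'n \<Rightarrow> real^'m) \<Rightarrow>
    (real^'n \<Rightarrow> 'b::real_normed_algebra_1) \<Rightarrow> bool" for U V \<theta> where
  base: "smooth_on U f \<Longrightarrow> sclass U V \<theta> f"
| comp: "smooth_on V f \<Longrightarrow> sclass U V \<theta> (\<lambda>x. f (\<theta> x))"
| add: "sclass U V \<theta> f \<Longrightarrow> sclass U V \<theta> g \<Longrightarrow> sclass U V \<theta> (\<lambda>x. f x + g x)"
| mult: "sclass U V \<theta> f \<Longrightarrow> sclass U V \<theta> g \<Longrightarrow> sclass U V \<theta> (\<lambda>x. f x * g x)"

lemma pd_add:
  assumes "f differentiable at x" "g differentiable at x"
  shows "(\<lambda>x. f x + g x) differentiable at x" "pd b (\<lambda>x. f x + g x) x = pd b f x + pd b g x"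
  using differentiableI[OF has_derivative_add[OF assms[THEN differentiable_has_pd]]]
    pd_unique[OF has_derivative_add[OF assms[THEN differentiable_has_pd]]] by blast+

lemma pd_mult:
  fixes f g :: "real^'n \<Rightarrow> 'b::real_normed_algebra"
  assumes "f differentiable at x" "g differentiable at x"
  shows "(\<lambda>x. f x * g x) differentiable at x"
    "pd b (\<lambda>x. f x * g x) x = f x * pd b g x + pd b f x * g x"
  using differentiableI[OF has_derivative_mult[OF assms[THEN differentiable_has_pd]]]
    pd_unique[OF has_derivative_mult[OF assms[THEN differentiable_has_pd]]] by blast+

lemma frechet_derivative_expand:
  fixes f :: "real^'n \<Rightarrow> 'b::real_normed_vector"
  assumes "f differentiable at x"
  shows "frechet_derivative f (at x) h = (\<Sum>j\<in>UNIV. h $ j *\<^sub>R pd (axis j 1) f x)"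
proof -
  have lin: "linear (frechet_derivative f (at x))"
    using assms by (rule linear_frechet_derivative)
  have "h = (\<Sum>j\<in>UNIV. h $ j *\<^sub>R axis j 1)"
    using basis_expansion[of h] by (simp add: scalar_mult_eq_scaleR)
  then have "frechet_derivative f (at x) h = frechet_derivative f (at x) (\<Sum>j\<in>UNIV. h $ j *\<^sub>R axis j 1)"
    by (rule arg_cong)
  also have "\<dots> = (\<Sum>j\<in>UNIV. h $ j *\<^sub>R pd (axis j 1) f x)"
    by (simp add: linear_sum[OF lin] linear_cmul[OF lin])
  finally show ?thesis .
qed

lemma pd_comp:
  fixes \<theta> :: "real^'n \<Rightarrow> real^'m" and f :: "real^'m \<Rightarrow> 'b::real_normed_algebra_1"
  assumes "\<theta> differentiable at x" "f differentiable at (\<theta> x)"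
  shows "(\<lambda>x. f (\<theta> x)) differentiable at x"
    "pd b (\<lambda>x. f (\<theta> x)) x = (\<Sum>j\<in>UNIV. of_real (pd b \<theta> x $ j) * pd (axis j 1) f (\<theta> x))"
proof -
  have "((\<lambda>x. f (\<theta> x)) has_derivative (\<lambda>h. frechet_derivative f (at (\<theta> x)) (frechet_derivative \<theta> (at x) h))) (at x)"
    using diff_chain_at[OF assms[THEN differentiable_has_pd]] by (simp add: o_def)
  note * = this
  show "(\<lambda>x. f (\<theta> x)) differentiable at x"
    using * by (rule differentiableI)
  have "pd b (\<lambda>x. f (\<theta> x)) x = frechet_derivative f (at (\<theta> x)) (pd b \<theta> x)"
    using * by (rule pd_unique)
  also have "\<dots> = (\<Sum>j\<in>UNIV. pd b \<theta> x $ j *\<^sub>R pd (axis j 1) f (\<theta> x))"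
    by (rule frechet_derivative_expand[OF assms(2)])
  finally show "pd b (\<lambda>x. f (\<theta> x)) x = (\<Sum>j\<in>UNIV. of_real (pd b \<theta> x $ j) * pd (axis j 1) f (\<theta> x))"
    by (simp only: scaleR_conv_of_real)
qed

lemma sclass_sum:
  assumes "finite I" "\<And>i. i \<in> I \<Longrightarrow> sclass U V \<theta> (f i)" "open U"
  shows "sclass U V \<theta> (\<lambda>x. \<Sum>i\<in>I. f i x)"
  using assms(1,2)
  by (induction I) (auto intro: sclass.add sclass.base smooth_on_const \<open>open U\<close>)

lemma axis_Basis: "axis j (1::real) \<in> Basis"
  by (auto simp: Basis_vec_def)

lemma smooth_on_component:
  fixes f :: "real^'n \<Rightarrow> real^'m"
  assumes "open U" "smooth_on U f"
  shows "smooth_on U (\<lambda>x. of_real (f x $ i) :: 'b::real_normed_algebra_1)"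
  by (rule smooth_on_bounded_linear[where L="\<lambda>v. of_real (v $ i)", OF _ assms])
     (intro bounded_linear_compose[OF bounded_linear_of_real] bounded_linear_vec_nth)

text \<open>The chain rule writes a partial derivative of \<open>f (\<theta> x)\<close> as a sum of
  products of components of derivatives of \<theta>, which enter through \<open>base\<close>, with
  partial derivatives of \<open>f\<close> taken at \<open>\<theta> x\<close>, which enter through
  \<open>comp\<close>. The product rule keeps the rest inside the class.\<close>

lemma sclass_step:
  assumes "open U" "smooth_on U \<theta>" "\<theta> ` U \<subseteq> V" "sclass U V \<theta> f"
  shows "(\<forall>x\<in>U. f differentiable at x) \<and> (\<forall>b\<in>Basis. \<exists>g. sclass U V \<theta> g \<and> (\<forall>x\<in>U. pd b f x = g x))"
  using assms(4)
proof induction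
  case (base f)
  then show ?case using smooth_on_differentiable smooth_on_pd sclass.base by metis
next
  case (comp f)
  have d: "\<theta> differentiable at x" "f differentiable at (\<theta> x)" if "x \<in> U" for x
    using that assms comp smooth_on_differentiable by blast+
  have "sclass U V \<theta> (\<lambda>x. \<Sum>j\<in>UNIV. of_real (pd b \<theta> x $ j) * pd (axis j 1) f (\<theta> x))"
    if "b \<in> Basis" for b
    using that comp assms
    by (intro sclass_sum sclass.mult sclass.base[OF smooth_on_component] sclass.comp
        smooth_on_pd axis_Basis finite_UNIV) auto
  then show ?case using pd_comp[OF d] by blast
next
  case (add f g)
  show ?case
  proof (intro conjI ballI)
    fix b :: "real^'a" assume "b \<in> Basis"
    with add.IH obtain f' g' where "sclass U V \<theta> f'" "sclass U V \<theta> g'"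
      "\<forall>x\<in>U. pd b f x = f' x" "\<forall>x\<in>U. pd b g x = g' x" by metis
    then show "\<exists>h. sclass U V \<theta> h \<and> (\<forall>x\<in>U. pd b (\<lambda>x. f x + g x) x = h x)"
      using add.IH by (intro exI[of _ "\<lambda>x. f' x + g' x"]) (auto simp: pd_add intro: sclass.add)
  qed (use add.IH pd_add(1) in blast)
next
  case (mult f g)
  show ?case
  proof (intro conjI ballI)
    fix b :: "real^'a" assume "b \<in> Basis"
    with mult.IH obtain f' g' where "sclass U V \<theta> f'" "sclass U V \<theta> g'"
      "\<forall>x\<in>U. pd b f x = f' x" "\<forall>x\<in>U. pd b g x = g' x" by metis
    then show "\<exists>h. sclass U V \<theta> h \<and> (\<forall>x\<in>U. pd b (\<lambda>x. f x * g x) x = h x)"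
      using mult by (intro exI[of _ "\<lambda>x. f x * g' x + f' x * g x"])
        (auto simp: pd_mult intro: sclass.add sclass.mult)
  qed (use mult.IH pd_mult(1) in blast)
qed

lemma sclass_smooth:
  assumes "open U" "smooth_on U \<theta>" "\<theta> ` U \<subseteq> V" "sclass U V \<theta> f"
  shows "smooth_on U f"
  by (rule smooth_on_coinduct[where P="sclass U V \<theta>"]) (use assms sclass_step in blast)+

lemma
  fixes f g :: "real^'n \<Rightarrow> 'b::real_normed_algebra_1"
  assumes "open U" "smooth_on U f" "smooth_on U g"
  shows smooth_on_add: "smooth_on U (\<lambda>x. f x + g x)"
    and smooth_on_mult: "smooth_on U (\<lambda>x. f x * g x)"
proof -
  \<comment> \<open>A constant map serves as inner function, so that the closure result for
    compositions specialises to plain sums and products.\<close>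
  have \<theta>: "smooth_on U (\<lambda>_. 0 :: real^'n)" "(\<lambda>_. 0) ` U \<subseteq> UNIV"
    by (simp_all add: smooth_on_const assms(1))
  note sc = sclass_smooth[OF assms(1) \<theta>]
  show "smooth_on U (\<lambda>x. f x + g x)" "smooth_on U (\<lambda>x. f x * g x)"
    by (rule sc, rule sclass.add sclass.mult; rule sclass.base; fact)+
qed

lemma smooth_on_comp:
  fixes f :: "real^'m \<Rightarrow> 'b::real_normed_algebra_1" and \<theta> :: "real^'n \<Rightarrow> real^'m"
  assumes "open U" "smooth_on U \<theta>" "\<theta> ` U \<subseteq> V" "smooth_on V f"
  shows "smooth_on U (\<lambda>x. f (\<theta> x))"
  by (rule sclass_smooth[OF assms(1-3) sclass.comp[OF assms(4)]])

lemma smooth_on_sum: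
  fixes f :: "'i \<Rightarrow> real^'n \<Rightarrow> 'b::real_normed_algebra_1"
  assumes "finite I" "open U" "\<And>i. i \<in> I \<Longrightarrow> smooth_on U (f i)"
  shows "smooth_on U (\<lambda>x. \<Sum>i\<in>I. f i x)"
  using assms(1,3) by (induction I) (auto intro: smooth_on_add smooth_on_const assms(2))

lemma smooth_on_prod:
  fixes f :: "'i \<Rightarrow> real^'n \<Rightarrow> 'b::{real_normed_algebra_1,comm_monoid_mult}"
  assumes "finite I" "open U" "\<And>i. i \<in> I \<Longrightarrow> smooth_on U (f i)"
  shows "smooth_on U (\<lambda>x. \<Prod>i\<in>I. f i x)"
  using assms(1,3) by (induction I) (auto intro: smooth_on_mult smooth_on_const assms(2))

lemma iterpd_add:
  assumes "open U" "smooth_on U f" "smooth_on U g" "set bs \<subseteq> Basis" "x \<in> U"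
  shows "iterpd bs (\<lambda>x. f x + g x) x = iterpd bs f x + iterpd bs g x"
  using assms(4,5)
proof (induction bs arbitrary: x)
  case (Cons b bs)
  have "iterpd bs f differentiable at x" "iterpd bs g differentiable at x"
    using assms(2,3) Cons.prems unfolding smooth_on_def by simp_all
  from pd_add(2)[OF this, of b]
  show ?case using frechet_derivative_cong_open[OF assms(1) Cons.prems(2) Cons.IH] Cons.prems by simp
qed simp

lemma iterpd_const_zero: "iterpd bs (\<lambda>_. 0) = (\<lambda>_. 0)"
  by (induction bs) simp_all

lemma iterpd_sum:
  fixes f :: "'i \<Rightarrow> real^'n \<Rightarrow> 'b::real_normed_algebra_1"
  assumes "finite I" "open U" "\<And>i. i \<in> I \<Longrightarrow> smooth_on U (f i)" "set bs \<subseteq> Basis" "x \<in> U"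
  shows "iterpd bs (\<lambda>x. \<Sum>i\<in>I. f i x) x = (\<Sum>i\<in>I. iterpd bs (f i) x)"
  using assms(1,3)
proof (induction I)
  case empty
  then show ?case by (simp add: iterpd_const_zero)
next
  case (insert i I)
  then show ?case
    using iterpd_add[OF assms(2) _ smooth_on_sum[OF insert.hyps(1) assms(2)] assms(4,5), of "f i" f]
    by simp
qed

subsection \<open>Seminorms of iterated partial derivatives\<close>

lemma tsupport_outside: "x \<notin> tsupport f \<Longrightarrow> f x = 0"
  using closure_subset[of "{x. f x \<noteq> 0}"] unfolding tsupport_def by blast

lemma tsupport_subset:
  assumes "closed K" "\<And>x. x \<notin> K \<Longrightarrow> f x = 0"
  shows "tsupport f \<subseteq> K"
  unfolding tsupport_def using assms by (intro closure_minimal) auto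

lemma iterpd_outside_tsupport:
  assumes "x \<notin> tsupport f"
  shows "iterpd bs f x = 0"
proof -
  have "iterpd bs f x = iterpd bs (\<lambda>_. 0) x"
    by (rule iterpd_cong_open[of "- tsupport f"])
      (use assms tsupport_outside in \<open>auto simp: tsupport_def\<close>)
  then show ?thesis by (simp add: iterpd_const_zero)
qed

section \<open>Multi-indices and lists of basis vectors\<close>

lemma axes_list_spec:
  fixes \<alpha> :: "'n::finite \<Rightarrow> nat"
  shows "count_list (axes_list \<alpha>) (axis i (1::real)) = \<alpha> i"
    and "set (axes_list \<alpha>) \<subseteq> range (\<lambda>i. axis i (1::real))"
proof -
  have "\<exists>bs. (\<forall>i. count_list bs (axis i (1::real)) = \<alpha> i) \<and> set bs \<subseteq> range (\<lambda>i. axis i (1::real))"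
  proof (induction "mabs \<alpha>" arbitrary: \<alpha>)
    case 0
    then show ?case by (intro exI[of _ "[]"]) (simp add: mabs_def)
  next
    case (Suc k)
    then obtain i where i: "\<alpha> i > 0"
      by (metis mabs_def sum.neutral nat.distinct(1) neq0_conv)
    let ?\<beta> = "\<alpha>(i := \<alpha> i - 1)"
    have "mabs \<alpha> = Suc (mabs ?\<beta>)"
      using i sum.remove[of UNIV i \<alpha>] sum.remove[of UNIV i ?\<beta>] by (simp add: mabs_def)
    then obtain bs where bs: "\<forall>j. count_list bs (axis j (1::real)) = ?\<beta> j"
      "set bs \<subseteq> range (\<lambda>i. axis i (1::real))"
      using Suc by (metis nat.inject)
    then show ?case
      using i by (intro exI[of _ "axis i 1 # bs"]) (auto simp: axis_eq_axis)
  qed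
  from someI_ex[OF this]
  show "count_list (axes_list \<alpha>) (axis i (1::real)) = \<alpha> i"
    "set (axes_list \<alpha>) \<subseteq> range (\<lambda>i. axis i (1::real))"
    unfolding axes_list_def by auto
qed

lemma length_eq_sum_count_axes:
  fixes bs :: "(real^'n) list"
  assumes "set bs \<subseteq> range (\<lambda>i. axis i (1::real))"
  shows "length bs = (\<Sum>i\<in>UNIV. count_list bs (axis i (1::real)))"
proof -
  have "length bs = sum (count_list bs) (range (\<lambda>i. axis i (1::real)))"
    using sum_count_set[OF assms] by simp
  also have "\<dots> = (\<Sum>i\<in>UNIV. count_list bs (axis i (1::real)))"
    by (subst sum.reindex) (auto simp: inj_on_def axis_eq_axis)
  finally show ?thesis .
qed

lemma length_axes_list: "length (axes_list \<alpha>) = mabs \<alpha>"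
  using length_eq_sum_count_axes[OF axes_list_spec(2)] by (simp add: axes_list_spec(1) mabs_def)

lemma set_axes_list: "set (axes_list \<alpha>) \<subseteq> Basis"
  using axes_list_spec(2) axis_Basis by blast

text \<open>The order of differentiation in the multi-index derivatives is arbitrary; bounding all
  iterated partial derivatives at once avoids the symmetry of mixed partials.\<close>
definition list_distribution :: "(real^'n::finite) set \<Rightarrow> ((real^'n \<Rightarrow> complex) \<Rightarrow> complex) \<Rightarrow> bool" where
  "list_distribution \<Omega> T \<longleftrightarrow>
     (\<forall>\<phi> \<eta>. test_fun \<Omega> \<phi> \<longrightarrow> test_fun \<Omega> \<eta> \<longrightarrow> T (\<lambda>x. \<phi> x + \<eta> x) = T \<phi> + T \<eta>) \<and>
     (\<forall>c \<phi>. test_fun \<Omega> \<phi> \<longrightarrow> T (\<lambda>x. c * \<phi> x) = c * T \<phi>) \<and>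
     (\<forall>K. compact K \<longrightarrow> K \<subseteq> \<Omega> \<longrightarrow>
        (\<exists>C\<ge>0. \<exists>m. \<forall>\<phi> B. test_fun \<Omega> \<phi> \<longrightarrow> tsupport \<phi> \<subseteq> K \<longrightarrow> 0 \<le> B \<longrightarrow>
          (\<forall>bs. set bs \<subseteq> Basis \<longrightarrow> length bs \<le> m \<longrightarrow> (\<forall>x\<in>K. norm (iterpd bs \<phi> x) \<le> B)) \<longrightarrow>
          norm (T \<phi>) \<le> C * B))"

text \<open>Each \<open>mderiv \<alpha>\<close> is one particular iterated derivative along a list
  of length \<open>mabs \<alpha>\<close>, so a common bound over all lists of length at most
  \<open>m\<close> dominates every summand of the original estimate.\<close>

lemma distribution_list_distribution:
  fixes T :: "(real^'n::finite \<Rightarrow> complex) \<Rightarrow> complex"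
  assumes "distribution \<Omega> T"
  shows "list_distribution \<Omega> T"
proof -
  have "\<exists>C\<ge>0. \<exists>m. \<forall>\<phi> B. test_fun \<Omega> \<phi> \<longrightarrow> tsupport \<phi> \<subseteq> K \<longrightarrow> 0 \<le> B \<longrightarrow>
          (\<forall>bs. set bs \<subseteq> Basis \<longrightarrow> length bs \<le> m \<longrightarrow> (\<forall>x\<in>K. norm (iterpd bs \<phi> x) \<le> B)) \<longrightarrow>
          norm (T \<phi>) \<le> C * B" if K: "compact K" "K \<subseteq> \<Omega>" for K
  proof -
    obtain C m where Cm: "\<And>\<phi>. test_fun \<Omega> \<phi> \<Longrightarrow> tsupport \<phi> \<subseteq> K \<Longrightarrow>
        norm (T \<phi>) \<le> C * (\<Sum>\<alpha>\<in>{\<alpha>. mabs \<alpha> \<le> m}. supnorm (mderiv \<alpha> \<phi>))"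
      using assms K unfolding distribution_def by meson
    let ?A = "{\<alpha> :: 'n \<Rightarrow> nat. mabs \<alpha> \<le> m}"
    \<comment> \<open>The given \<open>C\<close> may be negative; its absolute value makes the
      estimate monotone in the seminorms, and the number of multi-indices replaces the sum by a
      single bound.\<close>
    have "norm (T \<phi>) \<le> \<bar>C\<bar> * card ?A * B"
      if \<phi>: "test_fun \<Omega> \<phi>" "tsupport \<phi> \<subseteq> K" and B: "0 \<le> B"
        and le: "\<And>bs x. set bs \<subseteq> Basis \<Longrightarrow> length bs \<le> m \<Longrightarrow> x \<in> K \<Longrightarrow> norm (iterpd bs \<phi> x) \<le> B" for \<phi> B
    proof -
      have sup: "supnorm (mderiv \<alpha> \<phi>) \<le> B" "0 \<le> supnorm (mderiv \<alpha> \<phi>)" if "mabs \<alpha> \<le> m" for \<alpha> :: "'n \<Rightarrow> nat"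
      proof -
        have *: "norm (mderiv \<alpha> \<phi> x) \<le> B" for x
        proof (cases "x \<in> K")
          case True
          then show ?thesis
            unfolding mderiv_def using that by (intro le) (auto simp: set_axes_list length_axes_list)
        next
          case False
          then have "x \<notin> tsupport \<phi>"
            using \<phi>(2) by blast
          then show ?thesis
            using B by (simp add: mderiv_def iterpd_outside_tsupport)
        qed
        then show "supnorm (mderiv \<alpha> \<phi>) \<le> B"
          unfolding supnorm_def by (intro cSup_least) auto
        have "norm (mderiv \<alpha> \<phi> 0) \<le> supnorm (mderiv \<alpha> \<phi>)"
          unfolding supnorm_def using * by (intro cSup_upper bdd_aboveI[of _ B]) auto
        then show "0 \<le> supnorm (mderiv \<alpha> \<phi>)"
          using norm_ge_zero order_trans by blast
      qed
      have "norm (T \<phi>) \<le> C * (\<Sum>\<alpha>\<in>?A. supnorm (mderiv \<alpha> \<phi>))"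
        using Cm \<phi> by blast
      also have "\<dots> \<le> \<bar>C\<bar> * (\<Sum>\<alpha>\<in>?A. supnorm (mderiv \<alpha> \<phi>))"
        using sup(2) by (intro mult_right_mono sum_nonneg) auto
      also have "\<dots> \<le> \<bar>C\<bar> * (card ?A * B)"
        using sup(1) by (intro mult_left_mono sum_bounded_above) auto
      finally show ?thesis by (simp add: mult.assoc)
    qed
    then show ?thesis
      by (intro exI[of _ "\<bar>C\<bar> * card ?A"] conjI exI[of _ m]) auto
  qed
  then show ?thesis
    using assms unfolding distribution_def list_distribution_def by auto
qed

lemma list_distribution_add:
  "list_distribution \<Omega> T \<Longrightarrow> test_fun \<Omega> \<phi> \<Longrightarrow> test_fun \<Omega> \<eta> \<Longrightarrow> T (\<lambda>x. \<phi> x + \<eta> x) = T \<phi> + T \<eta>"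
  unfolding list_distribution_def by blast

lemma list_distribution_cmult:
  "list_distribution \<Omega> T \<Longrightarrow> test_fun \<Omega> \<phi> \<Longrightarrow> T (\<lambda>x. c * \<phi> x) = c * T \<phi>"
  unfolding list_distribution_def by blast

lemma list_distribution_bound:
  assumes "list_distribution \<Omega> T" "compact K" "K \<subseteq> \<Omega>"
  obtains C m where "C \<ge> 0" "\<And>\<phi> B. test_fun \<Omega> \<phi> \<Longrightarrow> tsupport \<phi> \<subseteq> K \<Longrightarrow> 0 \<le> B \<Longrightarrow>
    (\<And>bs x. set bs \<subseteq> Basis \<Longrightarrow> length bs \<le> m \<Longrightarrow> x \<in> K \<Longrightarrow> norm (iterpd bs \<phi> x) \<le> B) \<Longrightarrow>
    norm (T \<phi>) \<le> C * B"
proof -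
  have "\<exists>C\<ge>0. \<exists>m. \<forall>\<phi> B. test_fun \<Omega> \<phi> \<longrightarrow> tsupport \<phi> \<subseteq> K \<longrightarrow> 0 \<le> B \<longrightarrow>
    (\<forall>bs. set bs \<subseteq> Basis \<longrightarrow> length bs \<le> m \<longrightarrow> (\<forall>x\<in>K. norm (iterpd bs \<phi> x) \<le> B)) \<longrightarrow>
    norm (T \<phi>) \<le> C * B"
    using assms unfolding list_distribution_def by simp
  then obtain C m where "C \<ge> 0" and *: "\<forall>\<phi> B. test_fun \<Omega> \<phi> \<longrightarrow> tsupport \<phi> \<subseteq> K \<longrightarrow> 0 \<le> B \<longrightarrow>
    (\<forall>bs. set bs \<subseteq> Basis \<longrightarrow> length bs \<le> m \<longrightarrow> (\<forall>x\<in>K. norm (iterpd bs \<phi> x) \<le> B)) \<longrightarrow>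
    norm (T \<phi>) \<le> C * B"
    by (elim exE conjE)
  from \<open>C \<ge> 0\<close> show thesis
    by (rule that) (rule *[rule_format]; blast)
qed

text \<open>The point is that \<open>C\<close> is independent of \<eta>. Peeling off the innermost
  derivative, at the right end of the list, turns \<open>a y * \<eta> (\<theta> y)\<close> into a
  sum of terms of the same shape, with new smooth coefficients and with \<eta> or one of its first
  partial derivatives. The induction therefore runs from the right and leaves the coefficient
  \<open>a\<close> arbitrary.\<close>

lemma iterpd_comp_bound:
  fixes \<theta> :: "real^'n \<Rightarrow> real^'m" and a :: "real^'n \<Rightarrow> 'b::real_normed_algebra_1"
  assumes "open U" "open V" "smooth_on U \<theta>" "\<theta> ` U \<subseteq> V" "compact K" "K \<subseteq> U"
    and "set bs \<subseteq> Basis" "smooth_on U a"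
  shows "\<exists>C\<ge>0. \<forall>\<eta> B. smooth_on V \<eta> \<longrightarrow>
    (\<forall>cs. set cs \<subseteq> Basis \<longrightarrow> length cs \<le> length bs \<longrightarrow> (\<forall>x\<in>\<theta> ` K. norm (iterpd cs \<eta> x) \<le> B)) \<longrightarrow>
    (\<forall>y\<in>K. norm (iterpd bs (\<lambda>y. a y * \<eta> (\<theta> y)) y) \<le> C * B)"
  using assms(7,8)
proof (induction bs arbitrary: a rule: rev_induct)
  case Nil
  have "continuous_on K a"
    using smooth_on_continuous[OF Nil(2)] assms(6) continuous_on_subset by blast
  then have "bounded (a ` K)"
    using compact_continuous_image[OF _ assms(5)] compact_imp_bounded by blast
  then obtain C where C: "C > 0" "\<And>y. y \<in> K \<Longrightarrow> norm (a y) \<le> C"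
    unfolding bounded_pos by blast
  have "norm (a y * \<eta> (\<theta> y)) \<le> C * B"
    if "\<forall>cs. set cs \<subseteq> Basis \<longrightarrow> length cs \<le> length [] \<longrightarrow> (\<forall>x\<in>\<theta> ` K. norm (iterpd cs \<eta> x) \<le> B)" "y \<in> K"
    for \<eta> :: "real^'m \<Rightarrow> 'b" and B y
  proof -
    have "norm (\<eta> (\<theta> y)) \<le> B" using that by auto
    then show ?thesis
      using C that by (intro order_trans[OF norm_mult_ineq] mult_mono) auto
  qed
  then show ?case using C(1) by (intro exI[of _ C]) auto
next
  case (snoc b bs)
  then have b: "b \<in> Basis" and bs: "set bs \<subseteq> Basis" by auto
  let ?a = "\<lambda>j y. a y * of_real (pd b \<theta> y $ j)"
  have sa: "smooth_on U (pd b a)" "smooth_on U (?a j)" for j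
    using b snoc.prems assms(1,3)
    by (auto intro!: smooth_on_pd smooth_on_mult smooth_on_component)
  define Q where "Q a C \<longleftrightarrow> C \<ge> 0 \<and> (\<forall>\<eta> B. smooth_on V \<eta> \<longrightarrow>
    (\<forall>cs. set cs \<subseteq> Basis \<longrightarrow> length cs \<le> length bs \<longrightarrow> (\<forall>x\<in>\<theta> ` K. norm (iterpd cs \<eta> x) \<le> B)) \<longrightarrow>
    (\<forall>y\<in>K. norm (iterpd bs (\<lambda>y. a y * \<eta> (\<theta> y)) y) \<le> C * B))" for a :: "real^'n \<Rightarrow> 'b" and C
  have ex: "\<exists>C. Q a C" if "smooth_on U a" for a
    using snoc.IH[OF bs that] unfolding Q_def .
  have Q: "0 \<le> C" "norm (iterpd bs (\<lambda>y. a y * \<eta> (\<theta> y)) y) \<le> C * B"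
    if "Q a C" "smooth_on V \<eta>" "y \<in> K"
      "\<And>cs x. set cs \<subseteq> Basis \<Longrightarrow> length cs \<le> length bs \<Longrightarrow> x \<in> \<theta> ` K \<Longrightarrow> norm (iterpd cs \<eta> x) \<le> B"
    for a \<eta> C B y
    using that unfolding Q_def by blast+
  obtain C0 where C0: "Q (pd b a) C0" using ex[OF sa(1)] ..
  have "\<forall>j. \<exists>C. Q (?a j) C" using ex[OF sa(2)] by blast
  then obtain C1 where C1: "\<And>j. Q (?a j) (C1 j)"
    using choice[of "\<lambda>j. Q (?a j)"] by blast
  have "norm (iterpd (bs @ [b]) (\<lambda>y. a y * \<eta> (\<theta> y)) y) \<le> (C0 + (\<Sum>j\<in>UNIV. C1 j)) * B"
    if \<eta>: "smooth_on V \<eta>" and y: "y \<in> K"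
      and le: "\<And>cs x. set cs \<subseteq> Basis \<Longrightarrow> length cs \<le> length (bs @ [b]) \<Longrightarrow> x \<in> \<theta> ` K \<Longrightarrow> norm (iterpd cs \<eta> x) \<le> B"
    for \<eta> :: "real^'m \<Rightarrow> 'b" and B y
  proof -
    have yU: "y \<in> U" using y assms(6) by blast
    let ?t = "\<lambda>j y. ?a j y * pd (axis j 1) \<eta> (\<theta> y)"
    have sm: "smooth_on U (\<lambda>y. pd b a y * \<eta> (\<theta> y))" "smooth_on U (?t j)" for j
      using sa(1) snoc.prems(2) b \<eta> assms(1-4)
      by (auto intro!: smooth_on_component smooth_on_mult smooth_on_comp[where V=V and \<theta>=\<theta>] smooth_on_pd axis_Basis)
    have pd: "pd b (\<lambda>y. a y * \<eta> (\<theta> y)) z = pd b a z * \<eta> (\<theta> z) + (\<Sum>j\<in>UNIV. ?t j z)" if z: "z \<in> U" for z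
    proof -
      have d: "a differentiable at z" "\<theta> differentiable at z" "\<eta> differentiable at (\<theta> z)"
        using z snoc.prems(2) \<eta> assms(3,4) smooth_on_differentiable by blast+
      have "pd b (\<lambda>y. a y * \<eta> (\<theta> y)) z = a z * pd b (\<lambda>y. \<eta> (\<theta> y)) z + pd b a z * \<eta> (\<theta> z)"
        by (rule pd_mult(2)[OF d(1) pd_comp(1)[OF d(2,3)]])
      then show ?thesis
        by (simp add: pd_comp(2)[OF d(2,3)] sum_distrib_left mult.assoc)
    qed
    have "iterpd (bs @ [b]) (\<lambda>y. a y * \<eta> (\<theta> y)) y = iterpd bs (pd b (\<lambda>y. a y * \<eta> (\<theta> y))) y"
      by (simp add: iterpd_append)
    also have "\<dots> = iterpd bs (\<lambda>z. pd b a z * \<eta> (\<theta> z) + (\<Sum>j\<in>UNIV. ?t j z)) y"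
      by (rule iterpd_cong_open[OF assms(1) pd yU])
    also have "\<dots> = iterpd bs (\<lambda>z. pd b a z * \<eta> (\<theta> z)) y + (\<Sum>j\<in>UNIV. iterpd bs (?t j) y)"
      using sm assms(1) bs yU
      by (simp add: iterpd_add[OF assms(1) sm(1) smooth_on_sum] iterpd_sum)
    also have "norm \<dots> \<le> C0 * B + (\<Sum>j\<in>UNIV. C1 j * B)"
    proof (intro order_trans[OF norm_triangle_ineq] add_mono order_trans[OF norm_sum] sum_mono)
      show "norm (iterpd bs (\<lambda>z. pd b a z * \<eta> (\<theta> z)) y) \<le> C0 * B"
        using le by (intro Q(2)[OF C0 \<eta> y]) auto
      show "norm (iterpd bs (?t j) y) \<le> C1 j * B" for j
      proof (rule Q(2)[OF C1 smooth_on_pd[OF \<eta> axis_Basis] y])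
        fix cs :: "(real^'m) list" and x assume "set cs \<subseteq> Basis" "length cs \<le> length bs" "x \<in> \<theta> ` K"
        then show "norm (iterpd cs (pd (axis j 1) \<eta>) x) \<le> B"
          \<comment> \<open>A derivative of \<open>pd (axis j 1) \<eta>\<close> along
            \<open>cs\<close> is one of \<eta> along a list longer by one, still within the
            permitted length.\<close>
          using le[of "cs @ [axis j 1]" x] axis_Basis by (simp add: iterpd_append)
      qed
    qed
    finally show ?thesis by (simp add: algebra_simps sum_distrib_left sum_distrib_right)
  qed
  note bound = this
  show ?case
  proof (intro exI[of _ "C0 + (\<Sum>j\<in>UNIV. C1 j)"] conjI allI impI ballI)
    show "0 \<le> C0 + (\<Sum>j\<in>UNIV. C1 j)"
      using C0 C1 unfolding Q_def by (intro add_nonneg_nonneg sum_nonneg) auto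
  qed (rule bound; blast)
qed

subsection \<open>Pullback along a diffeomorphism\<close>

locale smooth_diffeo =
  fixes \<Omega> \<Omega>' :: "(real^'n::finite) set" and \<psi> :: "real^'n \<Rightarrow> real^'n"
  assumes open_\<Omega>: "open \<Omega>" and diffeo: "diffeo \<Omega>' \<Omega> \<psi>"
begin

definition \<theta> :: "real^'n \<Rightarrow> real^'n" where
  "\<theta> = inv_into \<Omega>' \<psi>"

definition jac :: "real^'n \<Rightarrow> real" where
  "jac y = \<bar>det (matrix (frechet_derivative \<theta> (at y)))\<bar>"

text \<open>The transpose of the pullback, acting on test functions.\<close>
definition push :: "(real^'n \<Rightarrow> complex) \<Rightarrow> real^'n \<Rightarrow> complex" where
  "push \<tau> y = (if y \<in> \<Omega> then \<tau> (\<theta> y) * complex_of_real (jac y) else 0)"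

lemma \<psi>_image: "\<psi> ` \<Omega>' = \<Omega>"
  using diffeo by (simp add: diffeo_def bij_betw_def)

lemma pullback_push: "pullback \<Omega>' \<psi> T \<tau> = T (push \<tau>)"
  unfolding pullback_def push_def[abs_def] jac_def \<theta>_def \<psi>_image ..

lemma \<theta>_\<psi>: "x \<in> \<Omega>' \<Longrightarrow> \<theta> (\<psi> x) = x"
  using diffeo by (simp add: diffeo_def bij_betw_def \<theta>_def)

lemma \<psi>_\<theta>: "y \<in> \<Omega> \<Longrightarrow> \<psi> (\<theta> y) = y"
  unfolding \<theta>_def \<psi>_image[symmetric] by (rule f_inv_into_f)

lemma \<theta>_image: "\<theta> ` \<Omega> = \<Omega>'"
  unfolding \<psi>_image[symmetric] image_image using \<theta>_\<psi> by simp

lemma smooth_\<psi>: "smooth_on \<Omega>' \<psi>" and smooth_\<theta>: "smooth_on \<Omega> \<theta>"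
  using diffeo by (simp_all add: diffeo_def \<theta>_def)

text \<open>Differentiating \<open>\<psi> (\<theta> y) = y\<close> gives the Jacobian matrix of
  \<theta> an inverse.\<close>

lemma det_nz:
  assumes "y \<in> \<Omega>"
  shows "det (matrix (frechet_derivative \<theta> (at y))) \<noteq> 0"
proof -
  let ?A = "frechet_derivative \<theta> (at y)" and ?B = "frechet_derivative \<psi> (at (\<theta> y))"
  have d: "(\<theta> has_derivative ?A) (at y)" "(\<psi> has_derivative ?B) (at (\<theta> y))"
    using smooth_on_differentiable[OF smooth_\<theta> assms] smooth_on_differentiable[OF smooth_\<psi>, of "\<theta> y"]
      \<theta>_image assms frechet_derivative_works by blast+
  have "((\<psi> \<circ> \<theta>) has_derivative ?B \<circ> ?A) (at y)"
    using diff_chain_at[OF d] .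
  then have "((\<lambda>y. y) has_derivative ?B \<circ> ?A) (at y)"
    by (rule has_derivative_transform_within_open[OF _ open_\<Omega> assms]) (simp add: \<psi>_\<theta>)
  then have "?B \<circ> ?A = id"
    using has_derivative_unique[OF _ has_derivative_ident] by (auto simp: id_def)
  then have "matrix ?B ** matrix ?A = mat 1"
    using d[THEN has_derivative_linear]
    by (metis matrix_compose matrix_id_mat_1)
  then have "det (matrix ?B) * det (matrix ?A) = 1"
    by (metis det_I det_mul)
  then show ?thesis by auto
qed

lemma smooth_det: "smooth_on \<Omega> (\<lambda>y. det (matrix (frechet_derivative \<theta> (at y))))"
proof -
  have *: "smooth_on \<Omega> (\<lambda>y. frechet_derivative \<theta> (at y) (axis j 1) $ i)" for i j
    using smooth_on_component[OF open_\<Omega> smooth_on_pd[OF smooth_\<theta> axis_Basis], where 'b=real, of j i]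
    by simp
  show ?thesis
    unfolding det_def matrix_def
    by (simp, intro smooth_on_sum smooth_on_mult smooth_on_prod smooth_on_const open_\<Omega> * finite_permutations)
      auto
qed

text \<open>The absolute value is not smooth at 0, but the determinant has no zero in \<Omega>. So
  \<Omega> is the union of two open sets, one for each sign, on which the Jacobian is the
  determinant times a constant sign.\<close>

lemma smooth_jac: "smooth_on \<Omega> (\<lambda>y. complex_of_real (jac y))"
proof -
  let ?d = "\<lambda>y. det (matrix (frechet_derivative \<theta> (at y)))"
  have cont: "continuous_on \<Omega> ?d"
    by (rule smooth_on_continuous[OF smooth_det])
  have sc: "smooth_on {y\<in>\<Omega>. 0 < s * ?d y} (\<lambda>y. complex_of_real (jac y))" if s: "\<bar>s\<bar> = 1" for s :: real
  proof (rule smooth_on_cong)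
    show o: "open {y\<in>\<Omega>. 0 < s * ?d y}"
      using continuous_open_preimage[OF continuous_on_mult[OF continuous_on_const[of _ s] cont] open_\<Omega>, of "{0<..}"]
      by (simp add: vimage_def Int_def)
    show "smooth_on {y\<in>\<Omega>. 0 < s * ?d y} (\<lambda>y. complex_of_real (s * ?d y))"
      by (rule smooth_on_bounded_linear[OF bounded_linear_of_real o])
        (intro smooth_on_mult smooth_on_const o smooth_on_subset[OF smooth_det]; auto)
    show "complex_of_real (jac y) = complex_of_real (s * ?d y)" if "y \<in> {y\<in>\<Omega>. 0 < s * ?d y}" for y
      using that s unfolding jac_def by (auto simp: abs_mult abs_of_pos dest: abs_of_pos)
  qed
  have "\<Omega> = {y\<in>\<Omega>. 0 < 1 * ?d y} \<union> {y\<in>\<Omega>. 0 < (-1) * ?d y}"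
    using det_nz by (auto simp: not_less order_le_less)
  then show ?thesis
    using smooth_on_Un[OF sc[of 1] sc[of "-1"]] by simp
qed

lemma compact_\<psi>_image:
  assumes "compact K" "K \<subseteq> \<Omega>'"
  shows "compact (\<psi> ` K)" "\<psi> ` K \<subseteq> \<Omega>" "\<theta> ` \<psi> ` K = K"
proof -
  show "compact (\<psi> ` K)"
    using smooth_on_continuous[OF smooth_\<psi>] assms compact_continuous_image continuous_on_subset by blast
  show "\<psi> ` K \<subseteq> \<Omega>" using assms \<psi>_image by blast
  show "\<theta> ` \<psi> ` K = K" using assms(2) \<theta>_\<psi> by (force simp: image_image)
qed

lemma smooth_push_aux:
  assumes "smooth_on UNIV \<tau>"
  shows "smooth_on \<Omega> (\<lambda>y. complex_of_real (jac y) * \<tau> (\<theta> y))"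
  by (intro smooth_on_mult smooth_jac open_\<Omega> smooth_on_comp[OF open_\<Omega> smooth_\<theta> _ assms]) simp

lemma test_fun_push:
  assumes "test_fun \<Omega>' \<tau>"
  shows "test_fun \<Omega> (push \<tau>)" "tsupport (push \<tau>) \<subseteq> \<psi> ` tsupport \<tau>"
proof -
  let ?K = "\<psi> ` tsupport \<tau>"
  have \<tau>: "smooth_on UNIV \<tau>" "compact (tsupport \<tau>)" "tsupport \<tau> \<subseteq> \<Omega>'"
    using assms by (auto simp: test_fun_def)
  note K = compact_\<psi>_image[OF \<tau>(2,3)]
  have zero: "push \<tau> y = 0" if "y \<notin> ?K" for y
  proof (rule ccontr)
    assume "push \<tau> y \<noteq> 0"
    then have "y \<in> \<Omega>" "\<tau> (\<theta> y) \<noteq> 0" by (auto simp: push_def split: if_splits)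
    then have "y \<in> ?K"
      using tsupport_outside \<psi>_\<theta> by (metis imageI)
    with that show False ..
  qed
  show sub: "tsupport (push \<tau>) \<subseteq> ?K"
    by (rule tsupport_subset[OF compact_imp_closed[OF K(1)] zero])
  have "smooth_on \<Omega> (push \<tau>)"
    by (rule smooth_on_cong[OF smooth_push_aux[OF \<tau>(1)] open_\<Omega>]) (simp add: push_def mult.commute)
  \<comment> \<open>Smoothness of the extension by zero: \<open>push \<tau>\<close> vanishes on the
    open complement of the compact set \<open>?K\<close>, and this complement together with \<Omega>
    covers the whole space.\<close>
  moreover have "smooth_on (- ?K) (push \<tau>)"
    by (rule smooth_on_cong[OF smooth_on_const[of "- ?K" 0]])
      (use zero K(1) compact_imp_closed in auto)
  ultimately have "smooth_on (\<Omega> \<union> - ?K) (push \<tau>)"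
    by (rule smooth_on_Un)
  moreover have "\<Omega> \<union> - ?K = UNIV" using K(2) by blast
  ultimately have "smooth_on UNIV (push \<tau>)" by simp
  moreover have "compact (tsupport (push \<tau>))"
    using compact_Int_closed[OF K(1), of "tsupport (push \<tau>)"] sub
    by (simp add: tsupport_def Int_absorb1)
  ultimately show "test_fun \<Omega> (push \<tau>)"
    using sub K(2) by (auto simp: test_fun_def)
qed

lemma list_distribution_pullback:
  assumes T: "list_distribution \<Omega> T"
  shows "list_distribution \<Omega>' (pullback \<Omega>' \<psi> T)"
proof -
  have "\<exists>C\<ge>0. \<exists>m. \<forall>\<phi> B. test_fun \<Omega>' \<phi> \<longrightarrow> tsupport \<phi> \<subseteq> K \<longrightarrow> 0 \<le> B \<longrightarrow>
          (\<forall>bs. set bs \<subseteq> Basis \<longrightarrow> length bs \<le> m \<longrightarrow> (\<forall>x\<in>K. norm (iterpd bs \<phi> x) \<le> B)) \<longrightarrow>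
          norm (T (push \<phi>)) \<le> C * B" if K: "compact K" "K \<subseteq> \<Omega>'" for K
  proof -
    note K' = compact_\<psi>_image[OF K]
    obtain C m where C: "C \<ge> 0" and Cm: "\<And>\<phi> B. test_fun \<Omega> \<phi> \<Longrightarrow> tsupport \<phi> \<subseteq> \<psi> ` K \<Longrightarrow> 0 \<le> B \<Longrightarrow>
          (\<And>bs x. set bs \<subseteq> Basis \<Longrightarrow> length bs \<le> m \<Longrightarrow> x \<in> \<psi> ` K \<Longrightarrow> norm (iterpd bs \<phi> x) \<le> B) \<Longrightarrow>
          norm (T \<phi>) \<le> C * B"
      using list_distribution_bound[OF T K'(1,2)] by blast
    \<comment> \<open>Only finitely many lists occur, so the sum of their individual constants is a
      constant valid for all of them.\<close>
    let ?L = "{bs :: (real^'n) list. set bs \<subseteq> Basis \<and> length bs \<le> m}"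
    have finL: "finite ?L" by (rule finite_lists_length_le) simp
    define Q where "Q bs D \<longleftrightarrow> D \<ge> 0 \<and> (\<forall>\<eta> B. smooth_on UNIV \<eta> \<longrightarrow>
      (\<forall>cs. set cs \<subseteq> Basis \<longrightarrow> length cs \<le> length bs \<longrightarrow> (\<forall>x\<in>\<theta> ` \<psi> ` K. norm (iterpd cs \<eta> x) \<le> B)) \<longrightarrow>
      (\<forall>y\<in>\<psi> ` K. norm (iterpd bs (\<lambda>y. complex_of_real (jac y) * \<eta> (\<theta> y)) y) \<le> D * B))" for bs D
    have "\<exists>D. Q bs D" if "bs \<in> ?L" for bs
      using that unfolding Q_def
      by (intro iterpd_comp_bound[OF open_\<Omega> open_UNIV smooth_\<theta> subset_UNIV K'(1,2)] smooth_jac) auto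
    then obtain D where QD: "\<And>bs. bs \<in> ?L \<Longrightarrow> Q bs (D bs)" by metis
    have D: "D bs \<ge> 0" if "bs \<in> ?L" for bs
      using QD[OF that] unfolding Q_def by blast
    have D2: "norm (iterpd bs (\<lambda>y. complex_of_real (jac y) * \<eta> (\<theta> y)) y) \<le> D bs * B"
      if "bs \<in> ?L" "smooth_on UNIV \<eta>" "y \<in> \<psi> ` K"
      "\<And>cs x. set cs \<subseteq> Basis \<Longrightarrow> length cs \<le> length bs \<Longrightarrow> x \<in> \<theta> ` \<psi> ` K \<Longrightarrow> norm (iterpd cs \<eta> x) \<le> B"
      for bs \<eta> B y
      using QD[OF that(1)] that(2-4) unfolding Q_def by blast
    have "norm (T (push \<phi>)) \<le> (C * sum D ?L) * B"
      if \<phi>: "test_fun \<Omega>' \<phi>" "tsupport \<phi> \<subseteq> K" and B: "0 \<le> B"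
        and le: "\<And>bs x. set bs \<subseteq> Basis \<Longrightarrow> length bs \<le> m \<Longrightarrow> x \<in> K \<Longrightarrow> norm (iterpd bs \<phi> x) \<le> B" for \<phi> B
    proof -
      have "norm (iterpd bs (push \<phi>) y) \<le> sum D ?L * B"
        if bs: "set bs \<subseteq> Basis" "length bs \<le> m" and y: "y \<in> \<psi> ` K" for bs y
      proof -
        have yO: "y \<in> \<Omega>" using y K'(2) by blast
        have "iterpd bs (push \<phi>) y = iterpd bs (\<lambda>y. complex_of_real (jac y) * \<phi> (\<theta> y)) y"
          by (rule iterpd_cong_open[OF open_\<Omega> _ yO]) (simp add: push_def)
        also have "norm \<dots> \<le> D bs * B"
        proof (rule D2[OF _ _ y])
          show "norm (iterpd cs \<phi> x) \<le> B"
            if "set cs \<subseteq> Basis" "length cs \<le> length bs" "x \<in> \<theta> ` \<psi> ` K" for cs x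
            using that bs(2) unfolding K'(3) by (intro le) auto
        qed (use bs \<phi>(1) in \<open>auto simp: test_fun_def\<close>)
        also have "\<dots> \<le> sum D ?L * B"
          using bs by (intro mult_right_mono B member_le_sum finL D) auto
        finally show ?thesis .
      qed
      then have "norm (T (push \<phi>)) \<le> C * (sum D ?L * B)"
        using test_fun_push[OF \<phi>(1)] \<phi>(2) B D
        by (intro Cm mult_nonneg_nonneg sum_nonneg) blast+
      then show ?thesis by (simp add: mult.assoc)
    qed
    then show ?thesis
      using C D by (intro exI[of _ "C * sum D ?L"] exI[of _ m] conjI mult_nonneg_nonneg sum_nonneg) auto
  qed
  moreover have "push (\<lambda>x. \<phi> x + \<eta> x) = (\<lambda>y. push \<phi> y + push \<eta> y)" for \<phi> \<eta>
    by (auto simp: push_def distrib_right)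
  moreover have "push (\<lambda>x. c * \<phi> x) = (\<lambda>y. c * push \<phi> y)" for c \<phi>
    by (auto simp: push_def)
  ultimately show ?thesis
    using list_distribution_add[OF T] list_distribution_cmult[OF T] test_fun_push(1) unfolding list_distribution_def pullback_push by auto
qed

end

subsection \<open>Convolution and distributions\<close>

text \<open>Integrating over a box makes continuity alone sufficient for integrability. It is the
  convolution on the whole space as soon as \<open>u\<close> vanishes outside the box.\<close>

abbreviation conv :: "real^'n \<Rightarrow> real^'n \<Rightarrow> (real^'n \<Rightarrow> complex) \<Rightarrow> (real^'n \<Rightarrow> complex) \<Rightarrow> real^'n \<Rightarrow> complex" where
  "conv a b u f \<equiv> \<lambda>t. integral (cbox a b) (\<lambda>x. u x * f (t - x))"

lemma continuous_on_translate:
  fixes f :: "real^'n \<Rightarrow> 'b::topological_space"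
  assumes "continuous_on UNIV f"
  shows "continuous_on S (\<lambda>x. f (t - x))"
proof -
  have "continuous_on S (\<lambda>x. t - x)"
    by (rule continuous_on_op_minus)
  then show ?thesis
    by (rule continuous_on_compose2[OF assms]) simp
qed

lemma has_derivative_translate:
  assumes "(f has_derivative D) (at (t - x))"
  shows "((\<lambda>t. f (t - x)) has_derivative D) (at t)"
proof -
  have "((\<lambda>t. t - x) has_derivative (\<lambda>h. h)) (at t)"
    by (auto intro!: derivative_eq_intros)
  from diff_chain_at[OF this assms] show ?thesis
    by (simp add: o_def)
qed

lemma integrable_conv:
  fixes u f :: "real^'n \<Rightarrow> complex"
  assumes "continuous_on UNIV u" "continuous_on UNIV f"
  shows "(\<lambda>x. u x * f (t - x)) integrable_on cbox a b"
  by (intro integrable_continuous continuous_on_mult continuous_on_translate[OF assms(2)])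
    (use assms(1) continuous_on_subset in blast)

lemma pd_conv:
  fixes u f :: "real^'n \<Rightarrow> complex"
  assumes u: "continuous_on UNIV u" and f: "smooth_on UNIV f"
  shows "conv a b u f differentiable at t"
    and "e \<in> Basis \<Longrightarrow> pd e (conv a b u f) t = conv a b u (pd e f) t"
proof -
  \<comment> \<open>Leibniz' rule takes the derivative as a continuous map into bounded linear
    functions; in finite dimension its continuity may be checked on basis vectors, that is, on the
    partial derivatives.\<close>
  define D where "D t x = Blinfun (\<lambda>h. u x * frechet_derivative f (at (t - x)) h)" for t x
  have cf: "continuous_on UNIV f" "\<And>e. e \<in> Basis \<Longrightarrow> continuous_on UNIV (pd e f)"
    using smooth_on_continuous f smooth_on_pd by blast+
  have der: "((\<lambda>t. u x * f (t - x)) has_derivative (\<lambda>h. u x * frechet_derivative f (at (t - x)) h)) (at t)" for t x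
  proof -
    have "(f has_derivative frechet_derivative f (at (t - x))) (at (t - x))"
      using smooth_on_differentiable[OF f] frechet_derivative_works by blast
    then have "((\<lambda>t. f (t - x)) has_derivative frechet_derivative f (at (t - x))) (at t)"
      by (rule has_derivative_translate)
    then show ?thesis by (rule has_derivative_mult_right)
  qed
  have D: "blinfun_apply (D t x) = (\<lambda>h. u x * frechet_derivative f (at (t - x)) h)" for t x
    unfolding D_def by (rule bounded_linear_Blinfun_apply[OF has_derivative_bounded_linear[OF der]])
  have cD: "continuous_on (UNIV \<times> cbox a b) (\<lambda>(t, x). D t x)"
  proof (rule continuous_on_blinfun_componentwise)
    fix e :: "real^'n" assume e: "e \<in> Basis"
    have "continuous_on (UNIV \<times> cbox a b) (\<lambda>z. u (snd z) * pd e f (fst z - snd z))"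
      by (intro continuous_on_mult continuous_on_compose2[OF u] continuous_on_compose2[OF cf(2)[OF e]] continuous_intros) auto
    then show "continuous_on (UNIV \<times> cbox a b) (\<lambda>z. blinfun_apply (case z of (t, x) \<Rightarrow> D t x) e)"
      by (simp add: case_prod_beta D)
  qed
  have L: "(conv a b u f has_derivative blinfun_apply (integral (cbox a b) (D t))) (at t within UNIV)"
    by (rule leibniz_rule[OF _ _ cD]) (auto simp: D der integrable_conv u cf(1))
  then show "conv a b u f differentiable at t"
    by (rule differentiableI)
  have iD: "D t integrable_on cbox a b"
    by (rule integrable_continuous, rule continuous_on_compose2[OF cD, of _ "\<lambda>x. (t, x)", simplified])
      (auto intro!: continuous_intros)
  show "pd e (conv a b u f) t = conv a b u (pd e f) t"
    using pd_unique[OF L] integral_linear[OF iD blinfun.bounded_linear_left, of e]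
    by (simp add: o_def D)
qed

lemma iterpd_conv:
  assumes u: "continuous_on UNIV u" and f: "smooth_on UNIV f" and bs: "set bs \<subseteq> Basis"
  shows "iterpd bs (conv a b u f) = conv a b u (iterpd bs f)"
  using bs
proof (induction bs)
  case (Cons e bs)
  then show ?case
    using pd_conv(2)[OF u smooth_on_iterpd[OF f, of bs], of e] by simp
qed simp

lemma smooth_conv:
  assumes u: "continuous_on UNIV u" and f: "smooth_on UNIV f"
  shows "smooth_on UNIV (conv a b u f)"
  unfolding smooth_on_def
  using iterpd_conv[OF assms] pd_conv(1)[OF u smooth_on_iterpd[OF f]] by simp

lemma
  fixes f :: "real^'n \<Rightarrow> 'b::real_normed_vector"
  assumes f: "smooth_on UNIV f"
  shows iterpd_translate: "set bs \<subseteq> Basis \<Longrightarrow> iterpd bs (\<lambda>t. f (t - x)) = (\<lambda>t. iterpd bs f (t - x))"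
    and smooth_translate: "smooth_on UNIV (\<lambda>t. f (t - x))"
proof -
  have der: "((\<lambda>t. g (t - x)) has_derivative frechet_derivative g (at (t - x))) (at t)"
    if "smooth_on UNIV g" for g :: "real^'n \<Rightarrow> 'b" and t
    using smooth_on_differentiable[OF that] frechet_derivative_works
    by (intro has_derivative_translate) blast
  have eq: "iterpd bs (\<lambda>t. f (t - x)) = (\<lambda>t. iterpd bs f (t - x))" if "set bs \<subseteq> Basis" for bs
    using that
  proof (induction bs)
    case (Cons e bs)
    then show ?case
      using pd_unique[OF der[OF smooth_on_iterpd[OF f, of bs]]] by simp
  qed simp
  show "smooth_on UNIV (\<lambda>t. f (t - x))"
    unfolding smooth_on_def using eq differentiableI[OF der[OF smooth_on_iterpd[OF f]]] by simp
  show "set bs \<subseteq> Basis \<Longrightarrow> iterpd bs (\<lambda>t. f (t - x)) = (\<lambda>t. iterpd bs f (t - x))"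
    by (rule eq)
qed

text \<open>On each cell the error is the integral of \<open>f y - f x\<close> with \<open>x\<close>
  the tag, at most \<open>e\<close> times the content of the cell; the contents add up to that of
  the box.\<close>

lemma riemann_sum_error:
  fixes f :: "'a::euclidean_space \<Rightarrow> 'b::banach"
  assumes f: "f integrable_on cbox a b" and p: "p tagged_division_of cbox a b" and e: "0 \<le> e"
    and osc: "\<And>x k y. (x, k) \<in> p \<Longrightarrow> y \<in> k \<Longrightarrow> norm (f y - f x) \<le> e"
  shows "norm (integral (cbox a b) f - (\<Sum>(x,k)\<in>p. measure lborel k *\<^sub>R f x)) \<le> e * measure lborel (cbox a b)"
proof -
  have "integral (cbox a b) f - (\<Sum>(x,k)\<in>p. measure lborel k *\<^sub>R f x)
      = (\<Sum>(x,k)\<in>p. integral k f - measure lborel k *\<^sub>R f x)"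
    by (simp add: integral_combine_tagged_division_topdown[OF f p] sum_subtractf case_prod_beta)
  also have "norm \<dots> \<le> (\<Sum>(x,k)\<in>p. e * measure lborel k)"
  proof (rule sum_norm_le, clarify)
    fix x k assume xk: "(x, k) \<in> p"
    then obtain c d where k: "k = cbox c d" "k \<subseteq> cbox a b"
      using p by (meson tagged_division_ofD(3,4))
    have fk: "f integrable_on k"
      using integrable_on_subcbox[OF f] k by blast
    have "((\<lambda>y. f y - f x) has_integral (integral k f - measure lborel k *\<^sub>R f x)) k"
      unfolding k(1) using fk k(1) by (intro has_integral_diff has_integral_const) (simp add: integrable_integral)
    then show "norm (integral k f - measure lborel k *\<^sub>R f x) \<le> e * measure lborel k"
      unfolding k(1) using osc[OF xk] k(1) by (intro has_integral_bound[OF e]) auto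
  qed
  also have "\<dots> = e * measure lborel (cbox a b)"
    unfolding additive_content_tagged_division[OF p, symmetric]
    by (simp add: sum_distrib_left case_prod_beta)
  finally show ?thesis .
qed

text \<open>Vanishing off a fixed set passes to sums, multiples and integrals pointwise, without
  computing closures of supports. For compact \<open>K\<close> inside \<Omega> it yields test
  functions on \<Omega>.\<close>

definition test_in :: "(real^'n) set \<Rightarrow> (real^'n \<Rightarrow> complex) \<Rightarrow> bool" where
  "test_in K f \<longleftrightarrow> smooth_on UNIV f \<and> (\<forall>t. t \<notin> K \<longrightarrow> f t = 0)"

lemma test_in_test_fun:
  assumes "test_in K f" "compact K" "K \<subseteq> \<Omega>"
  shows "test_fun \<Omega> f" "tsupport f \<subseteq> K"
proof -
  show sub: "tsupport f \<subseteq> K"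
    using assms by (intro tsupport_subset) (auto simp: test_in_def compact_imp_closed)
  have "compact (tsupport f)"
    using compact_Int_closed[OF assms(2), of "tsupport f"] sub
    by (simp add: tsupport_def Int_absorb1)
  then show "test_fun \<Omega> f"
    using assms sub by (auto simp: test_in_def test_fun_def)
qed

lemma test_fun_test_in: "test_fun \<Omega> f \<Longrightarrow> tsupport f \<subseteq> K \<Longrightarrow> test_in K f"
  by (auto simp: test_fun_def test_in_def intro: tsupport_outside)

lemma test_in_add: "test_in K f \<Longrightarrow> test_in K g \<Longrightarrow> test_in K (\<lambda>t. f t + g t)"
  by (auto simp: test_in_def intro: smooth_on_add)

lemma test_in_cmult: "test_in K f \<Longrightarrow> test_in K (\<lambda>t. c * f t)"
  by (auto simp: test_in_def intro: smooth_on_bounded_linear[OF bounded_linear_mult_right])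

lemma test_in_diff: "test_in K f \<Longrightarrow> test_in K g \<Longrightarrow> test_in K (\<lambda>t. f t - g t)"
  using test_in_add[OF _ test_in_cmult[of K g "-1"]] by simp

lemma test_in_zero: "test_in K (\<lambda>_. 0)"
  by (simp add: test_in_def smooth_on_const)

lemma test_in_sum:
  "finite I \<Longrightarrow> (\<And>i. i \<in> I \<Longrightarrow> test_in K (f i)) \<Longrightarrow> test_in K (\<lambda>t. \<Sum>i\<in>I. f i t)"
  by (induction I rule: finite_induct) (auto intro: test_in_add test_in_zero)

lemma iterpd_diff:
  fixes f g :: "real^'n \<Rightarrow> complex"
  assumes "smooth_on UNIV f" "smooth_on UNIV g" "set bs \<subseteq> Basis"
  shows "iterpd bs (\<lambda>x. f x - g x) x = iterpd bs f x - iterpd bs g x"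
  using iterpd_add[OF open_UNIV assms(1) smooth_on_bounded_linear[OF bounded_linear_mult_right[of "-1"] open_UNIV assms(2)] assms(3)]
    iterpd_bounded_linear[OF bounded_linear_mult_right[of "-1"] open_UNIV assms(2,3)] by simp

context
  fixes \<Omega> K :: "(real^'n::finite) set" and T :: "(real^'n \<Rightarrow> complex) \<Rightarrow> complex"
  assumes T: "list_distribution \<Omega> T" and K: "compact K" "K \<subseteq> \<Omega>"
begin

lemma distr_add: "test_in K f \<Longrightarrow> test_in K g \<Longrightarrow> T (\<lambda>t. f t + g t) = T f + T g"
  by (intro list_distribution_add[OF T] test_in_test_fun(1)[OF _ K])

lemma distr_cmult: "test_in K f \<Longrightarrow> T (\<lambda>t. c * f t) = c * T f"
  by (intro list_distribution_cmult[OF T] test_in_test_fun(1)[OF _ K])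

lemma distr_zero: "T (\<lambda>_. 0) = 0"
  using distr_cmult[OF test_in_zero, of 0] by simp

lemma distr_diff: "test_in K f \<Longrightarrow> test_in K g \<Longrightarrow> T (\<lambda>t. f t - g t) = T f - T g"
  using distr_add[OF _ test_in_cmult[of K g "-1"]] distr_cmult[of g "-1"] by simp

lemma distr_sum:
  "finite I \<Longrightarrow> (\<And>i. i \<in> I \<Longrightarrow> test_in K (f i)) \<Longrightarrow> T (\<lambda>t. \<Sum>i\<in>I. f i t) = (\<Sum>i\<in>I. T (f i))"
  by (induction I rule: finite_induct) (auto simp: distr_zero distr_add test_in_sum)

text \<open>A distribution commutes with the integral because the Riemann sums of the
  integral converge uniformly together with finitely many derivatives.\<close>
lemma distr_conv:
  assumes \<sigma>: "continuous_on UNIV \<sigma>" and f: "smooth_on UNIV f"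
    and supp: "\<And>x t. t \<notin> K \<Longrightarrow> \<sigma> x * f (t - x) = 0"
  shows "continuous_on (cbox a b) (\<lambda>x. T (\<lambda>t. \<sigma> x * f (t - x)))"
    and "T (conv a b \<sigma> f) = integral (cbox a b) (\<lambda>x. T (\<lambda>t. \<sigma> x * f (t - x)))"
proof -
  let ?g = "\<lambda>x t. \<sigma> x * f (t - x)"
  let ?F = "\<lambda>x. T (?g x)"
  let ?H = "conv a b \<sigma> f"
  have g: "test_in K (?g x)" for x
    using smooth_on_bounded_linear[OF bounded_linear_mult_right open_UNIV smooth_translate[OF f]] supp
    by (auto simp: test_in_def)
  have "?H t = 0" if "t \<notin> K" for t
    using supp[OF that] by (simp only: integral_0)
  then have H: "test_in K ?H"
    using smooth_conv[OF \<sigma> f] by (simp add: test_in_def)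
  have Dg: "iterpd bs (?g x) t = \<sigma> x * iterpd bs f (t - x)" if "set bs \<subseteq> Basis" for bs x t
    using iterpd_bounded_linear[OF bounded_linear_mult_right open_UNIV smooth_translate[OF f] that, of t "\<sigma> x" x]
      iterpd_translate[OF f that, of x] by simp
  obtain C m where C: "C \<ge> 0" and Cm: "\<And>\<phi> B. test_in K \<phi> \<Longrightarrow> 0 \<le> B \<Longrightarrow>
      (\<And>bs x. set bs \<subseteq> Basis \<Longrightarrow> length bs \<le> m \<Longrightarrow> x \<in> K \<Longrightarrow> norm (iterpd bs \<phi> x) \<le> B) \<Longrightarrow>
      norm (T \<phi>) \<le> C * B"
  proof -
    obtain C m where "C \<ge> 0" and Cm: "\<And>\<phi> B. test_fun \<Omega> \<phi> \<Longrightarrow> tsupport \<phi> \<subseteq> K \<Longrightarrow> 0 \<le> B \<Longrightarrow>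
      (\<And>bs x. set bs \<subseteq> Basis \<Longrightarrow> length bs \<le> m \<Longrightarrow> x \<in> K \<Longrightarrow> norm (iterpd bs \<phi> x) \<le> B) \<Longrightarrow>
      norm (T \<phi>) \<le> C * B"
      using list_distribution_bound[OF T K] by blast
    from \<open>C \<ge> 0\<close> show thesis
      by (rule that) (rule Cm[OF test_in_test_fun[OF _ K]])
  qed
  let ?L = "{bs :: (real^'n) list. set bs \<subseteq> Basis \<and> length bs \<le> m}"
  have finL: "finite ?L" by (rule finite_lists_length_le) simp
  \<comment> \<open>One \<open>d\<close> serves all derivatives up to order \<open>m\<close> and all
    \<open>t\<close> in \<open>K\<close>: each function of the pair \<open>(x, t)\<close> is
    uniformly continuous on the compact product, and there are finitely many of them.\<close>
  have unif: "\<exists>d>0. \<forall>x\<in>cbox a b. \<forall>x'\<in>cbox a b. dist x x' < d \<longrightarrow>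
      (\<forall>bs\<in>?L. \<forall>t\<in>K. norm (\<sigma> x * iterpd bs f (t - x) - \<sigma> x' * iterpd bs f (t - x')) \<le> e)"
    if e: "e > 0" for e
  proof -
    define P where "P bs d \<longleftrightarrow> d > 0 \<and> (\<forall>x\<in>cbox a b. \<forall>x'\<in>cbox a b. dist x x' < d \<longrightarrow>
      (\<forall>t\<in>K. norm (\<sigma> x * iterpd bs f (t - x) - \<sigma> x' * iterpd bs f (t - x')) \<le> e))" for bs d
    have "\<exists>d. P bs d" if "bs \<in> ?L" for bs
    proof -
      have cf: "continuous_on UNIV (iterpd bs f)"
        using that smooth_on_continuous smooth_on_iterpd[OF f] by blast
      have "continuous_on (cbox a b \<times> K) (\<lambda>z. \<sigma> (fst z))"
        by (rule continuous_on_compose2[OF \<sigma> continuous_on_fst[OF continuous_on_id]]) simp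
      moreover have "continuous_on (cbox a b \<times> K) (\<lambda>z. iterpd bs f (snd z - fst z))"
        by (rule continuous_on_compose2[OF cf continuous_on_diff[OF continuous_on_snd continuous_on_fst]])
          (auto intro: continuous_on_id)
      ultimately have "continuous_on (cbox a b \<times> K) (\<lambda>z. \<sigma> (fst z) * iterpd bs f (snd z - fst z))"
        by (rule continuous_on_mult)
      then have "uniformly_continuous_on (cbox a b \<times> K) (\<lambda>z. \<sigma> (fst z) * iterpd bs f (snd z - fst z))"
        by (intro compact_uniformly_continuous compact_Times K compact_cbox)
      then obtain d where "d > 0" and d: "\<And>z z'. z \<in> cbox a b \<times> K \<Longrightarrow> z' \<in> cbox a b \<times> K \<Longrightarrow> dist z' z < d \<Longrightarrow>
        dist (\<sigma> (fst z') * iterpd bs f (snd z' - fst z')) (\<sigma> (fst z) * iterpd bs f (snd z - fst z)) < e"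
        using e unfolding uniformly_continuous_on_def by meson
      have "norm (\<sigma> x * iterpd bs f (t - x) - \<sigma> x' * iterpd bs f (t - x')) \<le> e"
        if "x \<in> cbox a b" "x' \<in> cbox a b" "dist x x' < d" "t \<in> K" for x x' t
        using d[of "(x', t)" "(x, t)"] that by (auto simp: dist_Pair_Pair dist_norm)
      with \<open>d > 0\<close> show ?thesis unfolding P_def by blast
    qed
    then obtain d where Pd: "\<And>bs. bs \<in> ?L \<Longrightarrow> P bs (d bs)"
      using bchoice[of ?L P] by blast
    have d: "d bs > 0"
      "x \<in> cbox a b \<Longrightarrow> x' \<in> cbox a b \<Longrightarrow> dist x x' < d bs \<Longrightarrow> t \<in> K \<Longrightarrow>
        norm (\<sigma> x * iterpd bs f (t - x) - \<sigma> x' * iterpd bs f (t - x')) \<le> e" if "bs \<in> ?L" for bs x x' t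
      using Pd[OF that] unfolding P_def by blast+
    show ?thesis
    proof (intro exI[of _ "Min (insert 1 (d ` ?L))"] conjI ballI impI)
      show "0 < Min (insert 1 (d ` ?L))"
        using d(1) finL by (subst Min_gr_iff) auto
    qed (rule d(2), use finL in \<open>auto simp: Min_gr_iff\<close>)
  qed
  have F_osc: "norm (?F x - ?F x') \<le> C * e"
    if "e > 0" "\<And>bs t. bs \<in> ?L \<Longrightarrow> t \<in> K \<Longrightarrow> norm (\<sigma> x * iterpd bs f (t - x) - \<sigma> x' * iterpd bs f (t - x')) \<le> e"
    for x x' e
  proof -
    have "norm (T (\<lambda>t. ?g x t - ?g x' t)) \<le> C * e"
    proof (rule Cm[OF test_in_diff[OF g g]])
      fix bs :: "(real^'n) list" and t assume bs: "set bs \<subseteq> Basis" "length bs \<le> m" "t \<in> K"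
      have "iterpd bs (\<lambda>t. ?g x t - ?g x' t) t = \<sigma> x * iterpd bs f (t - x) - \<sigma> x' * iterpd bs f (t - x')"
        using iterpd_diff[OF _ _ bs(1), of "?g x" "?g x'" t] g Dg[OF bs(1)] by (simp add: test_in_def)
      then show "norm (iterpd bs (\<lambda>t. ?g x t - ?g x' t) t) \<le> e"
        using that(2)[of bs t] bs by simp
    qed (use that in simp)
    then show ?thesis by (simp add: distr_diff[OF g g])
  qed
  show cF: "continuous_on (cbox a b) ?F"
  proof (rule uniformly_continuous_imp_continuous, unfold uniformly_continuous_on_def, intro allI impI)
    fix e :: real assume e: "e > 0"
    \<comment> \<open>Adding 1 keeps the denominator positive when \<open>C\<close> is 0.\<close>
    define e' where "e' = e / (C + 1) / 2"
    have e': "e' > 0" "C * e' < e"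
      using e C by (auto simp: e'_def field_simps add_pos_nonneg add_nonneg_pos intro!: divide_pos_pos)
    from unif[OF e'(1)] obtain d where "d > 0" and d: "\<forall>x\<in>cbox a b. \<forall>x'\<in>cbox a b. dist x x' < d \<longrightarrow>
      (\<forall>bs\<in>?L. \<forall>t\<in>K. norm (\<sigma> x * iterpd bs f (t - x) - \<sigma> x' * iterpd bs f (t - x')) \<le> e')" by blast
    have "dist (?F x') (?F x) < e" if "x \<in> cbox a b" "x' \<in> cbox a b" "dist x' x < d" for x x'
    proof -
      have "norm (?F x' - ?F x) \<le> C * e'"
        by (rule F_osc[OF e'(1)]) (use d that in blast)
      then show ?thesis using e'(2) by (simp add: dist_norm)
    qed
    with \<open>d > 0\<close> show "\<exists>d>0. \<forall>x\<in>cbox a b. \<forall>x'\<in>cbox a b. dist x' x < d \<longrightarrow> dist (?F x') (?F x) < e"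
      by blast
  qed
  let ?v = "measure lborel (cbox a b)"
  have bound: "norm (T ?H - integral (cbox a b) ?F) \<le> 2 * (C * (e * ?v))" if e: "e > 0" for e
  proof -
    from unif[OF e] obtain d where "d > 0" and d: "\<forall>x\<in>cbox a b. \<forall>x'\<in>cbox a b. dist x x' < d \<longrightarrow>
      (\<forall>bs\<in>?L. \<forall>t\<in>K. norm (\<sigma> x * iterpd bs f (t - x) - \<sigma> x' * iterpd bs f (t - x')) \<le> e)" by blast
    have "gauge (\<lambda>x. ball x d)" using \<open>d > 0\<close> by (rule gauge_ball)
    then obtain p where p: "p tagged_division_of cbox a b" and fine: "(\<lambda>x. ball x d) fine p"
      by (rule fine_division_exists)
    have finp: "finite p" using p by (rule tagged_division_of_finite)
    have near: "norm (\<sigma> y * iterpd bs f (t - y) - \<sigma> x * iterpd bs f (t - x)) \<le> e"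
      if "(x, k) \<in> p" "y \<in> k" "bs \<in> ?L" "t \<in> K" for x k y bs t
    proof -
      have "x \<in> cbox a b" "y \<in> cbox a b"
        using tagged_division_ofD(2,3)[OF p that(1)] that(2) by blast+
      moreover have "dist y x < d"
        using fineD[OF fine that(1)] that(2) by (auto simp: dist_commute)
      ultimately show ?thesis using d that by blast
    qed
    \<comment> \<open>The Riemann sum, read as a function of \<open>t\<close>, is a finite
      combination of test functions, so \<open>T\<close> passes through it by linearity. It
      approximates \<open>?H\<close> in every seminorm in question, while its image under
      \<open>T\<close> is a Riemann sum for the integral of \<open>?F\<close>.\<close>
    let ?S = "\<lambda>t. \<Sum>i\<in>p. of_real (measure lborel (snd i)) * ?g (fst i) t"
    have gi: "test_in K (\<lambda>t. of_real (measure lborel (snd i)) * ?g (fst i) t)" for i :: "(real^'n) \<times> (real^'n) set"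
      using test_in_cmult[OF g] .
    have S: "test_in K ?S"
      by (rule test_in_sum[OF finp gi])
    have TS: "T ?S = (\<Sum>(x,k)\<in>p. measure lborel k *\<^sub>R ?F x)"
      unfolding distr_sum[OF finp gi] using distr_cmult[OF g]
      by (simp add: case_prod_beta scaleR_conv_of_real)
    have "norm (T (\<lambda>t. ?H t - ?S t)) \<le> C * (e * ?v)"
    proof (rule Cm[OF test_in_diff[OF H S]])
      fix bs :: "(real^'n) list" and t assume bs: "set bs \<subseteq> Basis" "length bs \<le> m" "t \<in> K"
      let ?r = "\<lambda>x. \<sigma> x * iterpd bs f (t - x)"
      have "iterpd bs (\<lambda>t. of_real (measure lborel (snd i)) * ?g (fst i) t) t = measure lborel (snd i) *\<^sub>R ?r (fst i)"
        for i :: "(real^'n) \<times> (real^'n) set"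
        using iterpd_bounded_linear[OF bounded_linear_mult_right open_UNIV _ bs(1), of "?g (fst i)" t "of_real (measure lborel (snd i))"]
          g Dg[OF bs(1)] by (simp add: test_in_def scaleR_conv_of_real)
      then have "iterpd bs ?S t = (\<Sum>(x,k)\<in>p. measure lborel k *\<^sub>R ?r x)"
        using iterpd_sum[OF finp open_UNIV _ bs(1), of "\<lambda>i t. of_real (measure lborel (snd i)) * ?g (fst i) t" t] gi
        by (simp add: test_in_def case_prod_beta)
      moreover have "iterpd bs ?H t = integral (cbox a b) ?r"
        by (simp add: iterpd_conv[OF \<sigma> f bs(1)])
      ultimately have "iterpd bs (\<lambda>t. ?H t - ?S t) t = integral (cbox a b) ?r - (\<Sum>(x,k)\<in>p. measure lborel k *\<^sub>R ?r x)"
        using iterpd_diff[OF _ _ bs(1), of ?H ?S t] H S by (simp add: test_in_def)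
      moreover have "norm (integral (cbox a b) ?r - (\<Sum>(x,k)\<in>p. measure lborel k *\<^sub>R ?r x)) \<le> e * ?v"
      proof (rule riemann_sum_error[OF _ p])
        show "?r integrable_on cbox a b"
          by (intro integrable_conv \<sigma> smooth_on_continuous smooth_on_iterpd[OF f] bs)
      qed (use e near bs in auto)
      ultimately show "norm (iterpd bs (\<lambda>t. ?H t - ?S t) t) \<le> e * ?v" by simp
    qed (use e in simp)
    then have "norm (T ?H - T ?S) \<le> C * (e * ?v)"
      by (simp add: distr_diff[OF H S])
    moreover have "norm (integral (cbox a b) ?F - T ?S) \<le> (C * e) * ?v"
      unfolding TS
    proof (rule riemann_sum_error[OF integrable_continuous[OF cF] p])
      show "norm (?F y - ?F x) \<le> C * e" if "(x, k) \<in> p" "y \<in> k" for x k y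
        by (rule F_osc[OF e]) (use near that in blast)
    qed (use C e in simp)
    ultimately show ?thesis
      using norm_triangle_ineq4[of "T ?H - T ?S" "integral (cbox a b) ?F - T ?S"] by (simp add: mult.assoc)
  qed
  show "T ?H = integral (cbox a b) ?F"
  proof (rule ccontr)
    assume "T ?H \<noteq> integral (cbox a b) ?F"
    then have n: "norm (T ?H - integral (cbox a b) ?F) > 0" (is "?n > 0") by simp
    \<comment> \<open>With this \<open>e\<close> the error bound is less than the distance
      \<open>?n\<close> that it is supposed to dominate.\<close>
    define e where "e = ?n / (4 * (C * ?v + 1))"
    have Cv: "C * ?v \<ge> 0" using C by simp
    then have e: "e > 0" unfolding e_def using n by (intro divide_pos_pos) auto
    have "2 * k * (n / (4 * (k + 1))) < n" if "k \<ge> 0" "n > 0" for k n :: real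
      using that by (simp add: field_simps add_pos_nonneg)
    from this[OF Cv n] have "2 * (C * (e * ?v)) < ?n"
      by (simp add: e_def mult_ac)
    then show False using bound[OF e] by simp
  qed
qed

end

subsection \<open>Approximation by mollifiers with vanishing moments\<close>

text \<open>Taylor's formula is indexed by ordered lists instead of multi-indices. A multi-index of
  order \<open>k\<close> is then counted once for each arrangement, which is why the coefficient
  below is 1 over \<open>fact k\<close>, and no symmetry of mixed partial derivatives
  enters.\<close>

abbreviation basis_lists :: "nat \<Rightarrow> (real^'n) list set" where
  "basis_lists k \<equiv> {c. set c \<subseteq> Basis \<and> length c = k}"

abbreviation monom :: "(real^'n) list \<Rightarrow> real^'n \<Rightarrow> real" where
  "monom c s \<equiv> prod_list (map ((\<bullet>) s) c)"

lemma finite_basis_lists: "finite (basis_lists k)"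
  by (rule finite_lists_length_eq) simp

lemma basis_lists_0: "basis_lists 0 = {[]}"
  by auto

lemma sum_basis_lists_Suc:
  "(\<Sum>c\<in>basis_lists (Suc k). g c) = (\<Sum>c\<in>basis_lists k. \<Sum>b\<in>Basis. g (b # c))"
  unfolding lists_length_Suc_eq
  by (subst sum.reindex) (auto simp: inj_on_def sum.cartesian_product intro!: sum.cong)

lemma frechet_derivative_expand_Basis:
  assumes "f differentiable at x"
  shows "frechet_derivative f (at x) h = (\<Sum>b\<in>Basis. (h \<bullet> b) *\<^sub>R pd b f x)"
proof -
  have lin: "linear (frechet_derivative f (at x))"
    using assms by (rule linear_frechet_derivative)
  have "frechet_derivative f (at x) h = frechet_derivative f (at x) (\<Sum>b\<in>Basis. (h \<bullet> b) *\<^sub>R b)"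
    by (simp only: euclidean_representation)
  also have "\<dots> = (\<Sum>b\<in>Basis. (h \<bullet> b) *\<^sub>R pd b f x)"
    by (simp add: linear_sum[OF lin] linear_cmul[OF lin])
  finally show ?thesis .
qed

lemma monom_bound:
  assumes "set c \<subseteq> Basis"
  shows "\<bar>monom c s\<bar> \<le> norm s ^ length c"
  using assms
proof (induction c)
  case (Cons b c)
  then show ?case
    using Basis_le_norm[of b s] by (auto simp: abs_mult intro!: mult_mono)
qed simp

lemma continuous_on_monom: "continuous_on S (monom c)"
  by (induction c) (auto intro!: continuous_intros)

text \<open>This is the one-dimensional Taylor formula with integral remainder for
  \<open>f (t - u *\<^sub>R s)\<close> as a function of \<open>u\<close> on [0, 1]. The remainder
  kernel is at most 1 there, which gives the simple constant.\<close>

lemma taylor_lists: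
  fixes f :: "real^'n \<Rightarrow> 'b::banach" and M :: real
  assumes f: "smooth_on UNIV f" and p: "0 < p"
    and M: "\<And>c x. c \<in> basis_lists p \<Longrightarrow> norm (iterpd c f x) \<le> M"
  shows "norm (f (t - s) - (\<Sum>i<p. \<Sum>c\<in>basis_lists i. ((-1)^i / fact i * monom c s) *\<^sub>R iterpd c f t))
    \<le> real (card (basis_lists p :: (real^'n) list set)) * M * norm s ^ p"
proof -
  \<comment> \<open>\<open>D k\<close> is the derivative of order \<open>k\<close> in
    \<open>u\<close>; each differentiation prepends a basis vector to the list and contributes one
    factor \<open>- (s \<bullet> b)\<close>.\<close>
  define D where "D k u = (\<Sum>c\<in>basis_lists k. ((-1)^k * monom c s) *\<^sub>R iterpd c f (t - u *\<^sub>R s))" for k u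
  have D0: "D 0 = (\<lambda>u. f (t - u *\<^sub>R s))"
    by (rule ext, unfold D_def basis_lists_0) simp
  have der: "(D k has_vector_derivative D (Suc k) u) (at u within A)" for k u A
  proof -
    have 1: "((\<lambda>u. iterpd c f (t - u *\<^sub>R s)) has_vector_derivative
        (\<Sum>b\<in>Basis. (- (s \<bullet> b)) *\<^sub>R iterpd (b # c) f (t - u *\<^sub>R s))) (at u within A)"
      if c: "c \<in> basis_lists k" for c
    proof -
      have d: "iterpd c f differentiable at (t - u *\<^sub>R s)"
        using c f unfolding smooth_on_def by blast
      have "((\<lambda>u. t - u *\<^sub>R s) has_derivative (\<lambda>h. - (h *\<^sub>R s))) (at u)"
        by (auto intro!: derivative_eq_intros)
      from diff_chain_at[OF this differentiable_has_pd[OF d]]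
      have "((\<lambda>u. iterpd c f (t - u *\<^sub>R s)) has_derivative
          (\<lambda>h. frechet_derivative (iterpd c f) (at (t - u *\<^sub>R s)) (- (h *\<^sub>R s)))) (at u)"
        by (simp add: o_def)
      moreover have "frechet_derivative (iterpd c f) (at (t - u *\<^sub>R s)) (- (h *\<^sub>R s)) =
          h *\<^sub>R (\<Sum>b\<in>Basis. (- (s \<bullet> b)) *\<^sub>R iterpd (b # c) f (t - u *\<^sub>R s))" for h
        unfolding frechet_derivative_expand_Basis[OF d, of "- (h *\<^sub>R s)"]
        by (simp add: scaleR_sum_right)
      ultimately show ?thesis
        unfolding has_vector_derivative_def by (simp add: has_derivative_at_withinI)
    qed
    have "(D k has_vector_derivative (\<Sum>c\<in>basis_lists k. ((-1)^k * monom c s) *\<^sub>R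
        (\<Sum>b\<in>Basis. (- (s \<bullet> b)) *\<^sub>R iterpd (b # c) f (t - u *\<^sub>R s)))) (at u within A)"
      unfolding D_def
      by (intro has_vector_derivative_sum bounded_linear.has_vector_derivative[OF bounded_linear_scaleR_right] 1)
    moreover have "(\<Sum>c\<in>basis_lists k. ((-1)^k * monom c s) *\<^sub>R
        (\<Sum>b\<in>Basis. (- (s \<bullet> b)) *\<^sub>R iterpd (b # c) f (t - u *\<^sub>R s))) = D (Suc k) u"
      unfolding D_def sum_basis_lists_Suc
      by (simp add: scaleR_sum_right mult_ac sum_negf)
    ultimately show ?thesis by simp
  qed
  have T: "((\<lambda>x. ((1 - x) ^ (p - 1) / fact (p - 1)) *\<^sub>R D p x) has_integral
      f (t - s) - (\<Sum>i<p. ((1 - 0) ^ i / fact i) *\<^sub>R D i 0)) {0..1}"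
    using Taylor_has_integral[of p D "\<lambda>u. f (t - u *\<^sub>R s)" 0 1, OF p D0 der] by simp
  have Dp: "norm (D p u) \<le> real (card (basis_lists p :: (real^'n) list set)) * M * norm s ^ p" for u
  proof -
    have "norm (D p u) \<le> (\<Sum>c\<in>(basis_lists p :: (real^'n) list set). norm s ^ p * M)"
      unfolding D_def
    proof (rule sum_norm_le)
      fix c :: "(real^'n) list" assume c: "c \<in> basis_lists p"
      then have "\<bar>monom c s\<bar> \<le> norm s ^ p" using monom_bound[of c s] by simp
      then show "norm (((-1)^p * monom c s) *\<^sub>R iterpd c f (t - u *\<^sub>R s)) \<le> norm s ^ p * M"
        using M[OF c] by (auto simp: abs_mult power_abs intro!: mult_mono)
    qed
    then show ?thesis by (simp add: mult_ac)
  qed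
  let ?B = "real (card (basis_lists p :: (real^'n) list set)) * M * norm s ^ p"
  have B0: "0 \<le> ?B" using order_trans[OF norm_ge_zero Dp] .
  have "norm (f (t - s) - (\<Sum>i<p. ((1 - 0) ^ i / fact i) *\<^sub>R D i 0)) \<le> ?B * measure lborel {0..1::real}"
  proof (rule has_integral_bound_real[OF B0 finite.emptyI T])
    fix x :: real assume x: "x \<in> {0..1} - {}"
    define w where "w = (1 - x) ^ (p - 1) / fact (p - 1)"
    have "w \<le> 1"
      using x power_le_one[of "1 - x" "p - 1"] by (simp add: w_def divide_le_eq order_trans[OF _ fact_ge_1])
    moreover have "0 \<le> w" using x by (simp add: w_def)
    ultimately have "norm (w *\<^sub>R D p x) \<le> ?B"
      using mult_mono[OF _ Dp[of x], of w 1] by simp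
    then show "norm (((1 - x) ^ (p - 1) / fact (p - 1)) *\<^sub>R D p x) \<le> ?B"
      by (simp only: w_def)
  qed
  then show ?thesis
    by (simp add: D_def scaleR_sum_right mult_ac)
qed

section \<open>Radius and moments of the mollifiers\<close>

lemma monom_eq_prod_power:
  fixes c :: "(real^'n) list"
  assumes "set c \<subseteq> Basis"
  shows "monom c s = (\<Prod>i\<in>UNIV. (s $ i) ^ count_list c (axis i 1))"
  using assms
proof (induction c)
  case (Cons b c)
  then obtain j where j: "b = axis j 1" by (auto simp: Basis_vec_def)
  have "(s $ i) ^ count_list (b # c) (axis i 1) = (if i = j then s $ i else 1) * (s $ i) ^ count_list c (axis i 1)" for i
    by (auto simp: j axis_eq_axis)
  then show ?case
    using Cons by (simp add: prod.distrib prod.delta j inner_axis)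
qed simp

lemma integral_UNIV_eq:
  fixes f :: "'a::euclidean_space \<Rightarrow> 'b::banach"
  assumes "\<And>x. x \<notin> S \<Longrightarrow> f x = 0"
  shows "integral UNIV f = integral S f"
proof -
  have "f = (\<lambda>x. if x \<in> S then f x else 0)" using assms by auto
  then show ?thesis using integral_restrict_UNIV[of S f] by simp
qed

lemma test_fun_norm_le_Rphi:
  assumes "test_fun UNIV \<phi>" "\<phi> x \<noteq> 0"
  shows "norm x \<le> Rphi \<phi>"
proof -
  have "bounded (tsupport \<phi>)" using assms(1) by (auto simp: test_fun_def intro: compact_imp_bounded)
  then obtain r where r: "\<And>x. x \<in> tsupport \<phi> \<Longrightarrow> norm x \<le> r" unfolding bounded_iff by blast
  have "bdd_above {norm x |x. \<phi> x \<noteq> 0}"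
    using r tsupport_outside by (intro bdd_aboveI[of _ r]) fastforce
  then have "norm x \<le> Sup {norm x |x. \<phi> x \<noteq> 0}"
    using assms(2) by (intro cSup_upper) auto
  then show ?thesis using assms(2) by (auto simp: Rphi_def)
qed

text \<open>With a radius that is not positive, \<phi> could be nonzero only at the origin, a null
  set, and its integral would be 0.\<close>

lemma Rphi_pos:
  assumes "test_fun UNIV \<phi>" "integral UNIV \<phi> \<noteq> 0"
  shows "Rphi \<phi> > 0"
proof (rule ccontr)
  assume "\<not> Rphi \<phi> > 0"
  then have "\<phi> x = 0" if "x \<noteq> 0" for x
    using test_fun_norm_le_Rphi[OF assms(1), of x] that by (metis norm_le_zero_iff order_trans not_less)
  then have "(\<phi> has_integral 0) UNIV"
    by (intro has_integral_spike[OF negligible_sing[of 0] _ has_integral_0]) auto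
  then show False using assms(2) by (simp add: integral_unique)
qed

lemma Dn_moment:
  fixes c :: "(real^'n::finite) list"
  assumes \<phi>: "\<phi> \<in> Dn n" and c: "set c \<subseteq> Basis" "length c \<le> n" "c \<noteq> []"
  shows "integral UNIV (\<lambda>s. of_real (monom c s) * \<phi> s) = 0"
proof -
  have r: "set c \<subseteq> range (\<lambda>i. axis i (1::real))"
    using c(1) by (auto simp: Basis_vec_def)
  define \<alpha> where "\<alpha> i = count_list c (axis i 1)" for i
  have "mabs \<alpha> = length c"
    unfolding mabs_def \<alpha>_def length_eq_sum_count_axes[OF r] ..
  then have "1 \<le> mabs \<alpha>" "mabs \<alpha> \<le> n"
    using c by (auto simp: Suc_le_eq)
  then have "integral UNIV (\<lambda>x. complex_of_real (\<Prod>i\<in>UNIV. (x $ i) ^ \<alpha> i) * \<phi> x) = 0"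
    using \<phi> by (auto simp: Dn_def)
  then show ?thesis
    by (simp only: monom_eq_prod_power[OF c(1)] \<alpha>_def)
qed

text \<open>Let \<open>P\<close> be the Taylor polynomial of \<open>f (t - s)\<close> in
  \<open>s\<close>. The moment conditions kill every term of the integral of
  \<open>\<phi> s * P s\<close> except the constant one, which gives \<open>f t\<close>. The error
  is thus the integral of \<phi> against the Taylor remainder, of size
  \<open>Rphi \<phi> ^ p\<close> on the support of \<phi>; the factor 2 bounds the integral of
  \<open>norm (\<phi> x)\<close>, which is at most \<open>1 + 1 / n\<close>.\<close>

lemma conv_Dn_approx:
  fixes f \<phi> :: "real^'n::finite \<Rightarrow> complex" and M :: real
  assumes \<phi>: "\<phi> \<in> Dn n" and n: "1 \<le> n" and p: "0 < p" "p \<le> n"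
    and f: "smooth_on UNIV f" and M: "\<And>c x. c \<in> basis_lists p \<Longrightarrow> norm (iterpd c f x) \<le> M"
    and ab: "cball 0 (Rphi \<phi>) \<subseteq> cbox a b"
  shows "norm (conv a b \<phi> f t - f t) \<le> 2 * (real (card (basis_lists p :: (real^'n) list set)) * M) * Rphi \<phi> ^ p"
proof -
  let ?R = "Rphi \<phi>" and ?k = "real (card (basis_lists p :: (real^'n) list set)) * M"
  have tf: "test_fun UNIV \<phi>" and int1: "integral UNIV \<phi> = 1"
    and intn: "integral UNIV (\<lambda>x. norm (\<phi> x)) \<le> 1 + 1 / real n"
    using \<phi> by (auto simp: Dn_def)
  \<comment> \<open>Some list of length \<open>p\<close> exists, so the hypothesis on
    \<open>M\<close> forces \<open>M\<close> to be nonnegative.\<close>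
  have "replicate p (axis undefined 1) \<in> (basis_lists p :: (real^'n) list set)"
    using axis_Basis by auto
  then have M0: "0 \<le> M"
    using order_trans[OF norm_ge_zero M] by blast
  then have k: "0 \<le> ?k" by simp
  have R: "?R > 0" using Rphi_pos[OF tf] int1 by simp
  have z: "\<phi> x = 0" if "x \<notin> cbox a b" for x
  proof (rule ccontr)
    assume "\<phi> x \<noteq> 0"
    then have "x \<in> cball 0 ?R" using test_fun_norm_le_Rphi[OF tf] by simp
    with that ab show False by blast
  qed
  have c\<phi>: "continuous_on S \<phi>" for S
    using tf smooth_on_continuous[of UNIV \<phi>] continuous_on_subset[of UNIV \<phi> S] by (auto simp: test_fun_def)
  have cf: "continuous_on UNIV f"
    using smooth_on_continuous[OF f] .
  define P where "P s = (\<Sum>i<p. \<Sum>c\<in>basis_lists i. ((-1)^i / fact i * monom c s) *\<^sub>R iterpd c f t)" for s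
  have cP: "continuous_on S P" for S
    unfolding P_def by (intro continuous_intros continuous_on_monom)
  have mz: "integral (cbox a b) (\<lambda>s. of_real (monom c s) * \<phi> s) = (if c = [] then 1 else 0)"
    if "c \<in> basis_lists i" "i < p" for c i
  proof (cases "c = []")
    case True
    then show ?thesis using int1 integral_UNIV_eq[of "cbox a b" \<phi>, OF z] by simp
  next
    case False
    then show ?thesis
      using Dn_moment[OF \<phi>, of c] that p integral_UNIV_eq[of "cbox a b" "\<lambda>s. of_real (monom c s) * \<phi> s"] z
      by auto
  qed
  have iP: "((\<lambda>s. \<phi> s * P s) has_integral f t) (cbox a b)"
  proof -
    have "((\<lambda>s. (of_real (monom c s) * \<phi> s) * (of_real ((-1)^i / fact i) * iterpd c f t)) has_integral
        (if c = [] then 1 else 0) * (of_real ((-1)^i / fact i) * iterpd c f t)) (cbox a b)"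
      if "c \<in> basis_lists i" "i < p" for c i
    proof (rule has_integral_mult_left)
      have "(\<lambda>s. of_real (monom c s) * \<phi> s) integrable_on cbox a b"
        by (intro integrable_continuous continuous_intros continuous_on_monom c\<phi>)
      then show "((\<lambda>s. of_real (monom c s) * \<phi> s) has_integral (if c = [] then 1 else 0)) (cbox a b)"
        using mz[OF that] by (simp add: has_integral_integrable_integral)
    qed
    then have "((\<lambda>s. \<Sum>i<p. \<Sum>c\<in>basis_lists i. (of_real (monom c s) * \<phi> s) * (of_real ((-1)^i / fact i) * iterpd c f t)) has_integral
        (\<Sum>i<p. \<Sum>c\<in>basis_lists i. (if c = [] then 1 else 0) * (of_real ((-1)^i / fact i) * iterpd c f t))) (cbox a b)"
      by (intro has_integral_sum finite_basis_lists) auto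
    moreover have "(\<Sum>i<p. \<Sum>c\<in>basis_lists i. (if c = [] then 1 else 0) * (of_real ((-1)^i / fact i) * iterpd c f t)) = f t"
    proof -
      have "(\<Sum>c\<in>basis_lists i. (if c = [] then 1 else 0) * (of_real ((-1)^i / fact i) * iterpd c f t)) = (if i = 0 then f t else 0)" for i
      proof (cases i)
        case 0
        then show ?thesis by (simp only: basis_lists_0) simp
      qed (auto intro!: sum.neutral)
      then show ?thesis using p by (simp add: sum.delta)
    qed
    ultimately show ?thesis
      by (simp add: P_def sum_distrib_left scaleR_conv_of_real mult_ac)
  qed
  have "norm (integral (cbox a b) (\<lambda>s. \<phi> s * (f (t - s) - P s))) \<le> integral (cbox a b) (\<lambda>s. norm (\<phi> s) * (?k * ?R ^ p))"
  proof (rule integral_norm_bound_integral)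
    show "(\<lambda>s. \<phi> s * (f (t - s) - P s)) integrable_on cbox a b"
      by (intro integrable_continuous continuous_on_mult c\<phi> continuous_on_diff continuous_on_translate[OF cf] cP)
    show "(\<lambda>s. norm (\<phi> s) * (?k * ?R ^ p)) integrable_on cbox a b"
      by (intro integrable_continuous continuous_intros c\<phi>)
    fix s
    show "norm (\<phi> s * (f (t - s) - P s)) \<le> norm (\<phi> s) * (?k * ?R ^ p)"
    proof (cases "\<phi> s = 0")
      case False
      have "norm (f (t - s) - P s) \<le> ?k * norm s ^ p"
        unfolding P_def by (rule taylor_lists[OF f p(1) M])
      also have "\<dots> \<le> ?k * ?R ^ p"
        using k test_fun_norm_le_Rphi[OF tf False] by (intro mult_left_mono power_mono) auto
      finally show ?thesis by (simp add: norm_mult mult_left_mono)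
    qed simp
  qed
  also have "\<dots> = integral UNIV (\<lambda>x. norm (\<phi> x)) * (?k * ?R ^ p)"
    using integral_UNIV_eq[of "cbox a b" "\<lambda>x. norm (\<phi> x)"] z by simp
  also have "\<dots> \<le> 2 * (?k * ?R ^ p)"
  proof (rule mult_right_mono)
    show "integral UNIV (\<lambda>x. norm (\<phi> x)) \<le> 2"
      using n by (intro order_trans[OF intn]) (simp add: field_simps)
    show "0 \<le> ?k * ?R ^ p"
      using M0 R by simp
  qed
  also have "integral (cbox a b) (\<lambda>s. \<phi> s * (f (t - s) - P s)) = conv a b \<phi> f t - f t"
  proof -
    have "((\<lambda>s. \<phi> s * f (t - s)) has_integral conv a b \<phi> f t) (cbox a b)"
      using integrable_conv[OF c\<phi> cf] by (rule integrable_integral)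
    from has_integral_diff[OF this iP] show ?thesis
      by (simp add: integral_unique right_diff_distrib)
  qed
  finally show ?thesis by (simp add: mult.assoc)
qed

subsection \<open>Change of variables\<close>

text \<open>The library's change of variables theorem needs a well-ordered index type. Any finite
  index type becomes one after wrapping, since it embeds into the natural numbers.\<close>
datatype 'a idx = Idx (unIdx: 'a)

instance idx :: (finite) finite
proof
  have "(UNIV :: 'a idx set) \<subseteq> range Idx"
    by (metis idx.exhaust rangeI subsetI)
  then show "finite (UNIV :: 'a idx set)"
    by (rule finite_subset[OF _ finite_imageI[OF finite]])
qed

instantiation idx :: (countable) wellorder
begin

definition less_eq_idx :: "'a idx \<Rightarrow> 'a idx \<Rightarrow> bool" where
  "less_eq_idx x y \<longleftrightarrow> to_nat (unIdx x) \<le> to_nat (unIdx y)"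

definition less_idx :: "'a idx \<Rightarrow> 'a idx \<Rightarrow> bool" where
  "less_idx x y \<longleftrightarrow> to_nat (unIdx x) < to_nat (unIdx y)"

instance
proof
  fix P :: "'a idx \<Rightarrow> bool" and a
  assume *: "\<And>x. (\<And>y. y < x \<Longrightarrow> P y) \<Longrightarrow> P x"
  show "P a"
    by (induction "to_nat (unIdx a)" arbitrary: a rule: less_induct) (use * less_idx_def in blast)
qed (auto simp: less_eq_idx_def less_idx_def intro: idx.expand)

end

section \<open>Relabelling coordinates: boxes, integrals and determinants\<close>

definition relabel :: "real^'n \<Rightarrow> real^('n idx)" where
  "relabel x = (\<chi> i. x $ unIdx i)"

definition unrelabel :: "real^('n idx) \<Rightarrow> real^'n" where
  "unrelabel y = (\<chi> i. y $ Idx i)"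

lemma relabel_unrelabel [simp]: "relabel (unrelabel y) = y" "unrelabel (relabel x) = x"
  by (simp_all add: relabel_def unrelabel_def vec_eq_iff)

lemma linear_relabel: "linear (relabel :: real^'n::finite \<Rightarrow> _)" "linear (unrelabel :: _ \<Rightarrow> real^'n::finite)"
  by (auto intro!: linearI simp: relabel_def unrelabel_def vec_eq_iff)

lemma bounded_linear_relabel:
  "bounded_linear (relabel :: real^'n::finite \<Rightarrow> _)" "bounded_linear (unrelabel :: _ \<Rightarrow> real^'n::finite)"
  using linear_relabel linear_conv_bounded_linear by blast+

lemma relabel_cbox:
  fixes a b :: "real^'n::finite"
  shows "relabel ` cbox a b = cbox (relabel a) (relabel b)"
    "unrelabel ` cbox c d = cbox (unrelabel c) (unrelabel d :: real^'n)"
proof -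
  have 1: "relabel x \<in> cbox (relabel a) (relabel b)" if "x \<in> cbox a b" for x a b :: "real^'n"
    using that by (auto simp: relabel_def mem_box_cart)
  have 2: "unrelabel x \<in> cbox (unrelabel a) (unrelabel b :: real^'n)" if "x \<in> cbox a b" for x a b
    using that by (auto simp: unrelabel_def mem_box_cart)
  show "relabel ` cbox a b = cbox (relabel a) (relabel b)"
    using 1[of _ a b] 2[of _ "relabel a" "relabel b"] by (force intro: image_eqI[of _ relabel "unrelabel _"])
  show "unrelabel ` cbox c d = cbox (unrelabel c) (unrelabel d :: real^'n)"
    using 2[of _ c d] 1[of _ "unrelabel c" "unrelabel d"] by (force intro: image_eqI[of _ unrelabel "relabel _"])
qed

lemma bij_Idx: "bij Idx" "bij unIdx"
  by (metis bij_betw_def idx.inject idx.exhaust inj_def surj_def,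
      metis bij_betw_def idx.sel idx.expand inj_def surj_def)

lemma content_relabel:
  fixes a b :: "real^'n::finite"
  shows "measure lborel (cbox (relabel a) (relabel b)) = measure lborel (cbox a b)"
proof -
  have "cbox (relabel a) (relabel b) = {} \<longleftrightarrow> cbox a b = {}"
    unfolding relabel_cbox(1)[symmetric] by simp
  moreover have "(\<Prod>i\<in>UNIV. relabel b $ i - relabel a $ i) = (\<Prod>i\<in>UNIV. b $ i - a $ i)"
    unfolding relabel_def using prod.reindex_bij_betw[OF bij_Idx(2), of "\<lambda>i. b $ i - a $ i"] by simp
  ultimately show ?thesis by (simp add: content_cbox_if_cart)
qed

text \<open>Renaming coordinates maps boxes onto boxes of the same content, in both directions, so
  it preserves gauge integrals.\<close>

lemma has_integral_relabel:
  fixes f :: "real^'n::finite \<Rightarrow> 'b::banach"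
  shows "((\<lambda>x. f (unrelabel x)) has_integral i) (cbox (relabel a) (relabel b)) \<longleftrightarrow> (f has_integral i) (cbox a b)"
proof
  have ex: "\<exists>w z. unrelabel ` cbox u v = cbox w (z :: real^'n)" "\<exists>w z. relabel ` cbox x y = cbox w z"
    for u v and x y :: "real^'n"
    using relabel_cbox by blast+
  have cont: "continuous (at x) (unrelabel :: _ \<Rightarrow> real^'n)" "continuous (at y) (relabel :: real^'n \<Rightarrow> _)" for x y
    by (simp_all add: linear_continuous_at bounded_linear_relabel)
  have c: "measure lborel (unrelabel ` cbox u v :: (real^'n) set) = 1 * measure lborel (cbox u v)" for u v
    using content_relabel[of "unrelabel u" "unrelabel v"] by (simp add: relabel_cbox)
  have c': "measure lborel (relabel ` cbox u v) = 1 * measure lborel (cbox u v)" for u v :: "real^'n"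
    by (simp add: relabel_cbox content_relabel)
  show "((\<lambda>x. f (unrelabel x)) has_integral i) (cbox (relabel a) (relabel b))" if "(f has_integral i) (cbox a b)"
    using has_integral_twiddle[of 1 relabel unrelabel f i a b, OF _ _ _ cont(1) ex c that]
    by (simp add: relabel_cbox)
  show "(f has_integral i) (cbox a b)" if "((\<lambda>x. f (unrelabel x)) has_integral i) (cbox (relabel a) (relabel b))"
    using has_integral_twiddle[of 1 unrelabel relabel "\<lambda>x. f (unrelabel x)" i "relabel a" "relabel b", OF _ _ _ cont(2) ex(2,1) c' that]
    by (simp add: relabel_cbox)
qed

text \<open>Conjugating with the bijection \<open>Idx\<close> carries transpositions to
  transpositions. Hence it preserves parity, the only nontrivial point in the invariance of the
  determinant.\<close>

lemma swapidseq_Idx: "swapidseq n p \<Longrightarrow> swapidseq n (Idx \<circ> p \<circ> unIdx)"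
proof (induction rule: swapidseq.induct)
  case id
  have "Idx \<circ> id \<circ> unIdx = id" by (simp add: fun_eq_iff)
  then show ?case using swapidseq.id by metis
next
  case (comp_Suc n p a b)
  have "Idx \<circ> (Transposition.transpose a b \<circ> p) \<circ> unIdx
      = Transposition.transpose (Idx a) (Idx b) \<circ> (Idx \<circ> p \<circ> unIdx)"
    by (auto simp: fun_eq_iff Transposition.transpose_def)
  then show ?case
    using swapidseq.comp_Suc[OF comp_Suc.IH, of "Idx a" "Idx b"] comp_Suc.hyps by (simp only: idx.inject simp_thms)
qed

lemma sign_Idx:
  fixes p :: "'n::finite \<Rightarrow> 'n"
  assumes "p permutes UNIV"
  shows "sign (Idx \<circ> p \<circ> unIdx) = sign p"
proof -
  have "permutation p"
    by (rule permutes_imp_permutation[OF finite assms])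
  then obtain n where n: "swapidseq n p"
    unfolding permutation_def ..
  show ?thesis
    unfolding sign_def using evenperm_unique[OF n refl] evenperm_unique[OF swapidseq_Idx[OF n] refl] by simp
qed

lemma det_relabel:
  fixes A :: "real^'n^'n::finite"
  shows "det (\<chi> i j. A $ unIdx i $ unIdx j ) = det A"
proof -
  let ?h = "\<lambda>p :: 'n \<Rightarrow> 'n. Idx \<circ> p \<circ> unIdx"
  have bij: "bij_betw ?h {p. p permutes UNIV} {p. p permutes UNIV}"
  proof (rule bij_betwI[where g="\<lambda>q. unIdx \<circ> q \<circ> Idx"])
    show "?h \<in> {p. p permutes UNIV} \<rightarrow> {p. p permutes UNIV}"
      using bij_Idx by (auto intro!: bij_imp_permutes bij_comp dest: permutes_bij)
    show "(\<lambda>q. unIdx \<circ> q \<circ> Idx) \<in> {p. p permutes (UNIV :: 'n idx set)} \<rightarrow> {p. p permutes (UNIV :: 'n set)}"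
      using bij_Idx by (auto intro!: bij_imp_permutes bij_comp dest: permutes_bij)
  qed (auto simp: fun_eq_iff)
  have "det (\<chi> i j. A $ unIdx i $ unIdx j) =
      (\<Sum>p\<in>{p. p permutes UNIV}. of_int (sign (?h p)) * (\<Prod>i\<in>UNIV. A $ unIdx i $ unIdx (?h p i)))"
    unfolding det_def vec_lambda_beta
    by (rule sum.reindex_bij_betw[OF bij, symmetric])
  also have "\<dots> = det A"
    unfolding det_def
  proof (rule sum.cong[OF refl])
    fix p :: "'n \<Rightarrow> 'n" assume "p \<in> {p. p permutes UNIV}"
    then show "of_int (sign (?h p)) * (\<Prod>i\<in>UNIV. A $ unIdx i $ unIdx (?h p i)) = of_int (sign p) * (\<Prod>i\<in>UNIV. A $ i $ p i)"
      using sign_Idx[of p] prod.reindex_bij_betw[OF bij_Idx(2), of "\<lambda>i. A $ i $ p i"] by simp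
  qed
  finally show ?thesis .
qed

lemma matrix_relabel:
  fixes L :: "real^'n::finite \<Rightarrow> real^'n"
  shows "matrix (relabel \<circ> L \<circ> unrelabel) = (\<chi> i j. matrix L $ unIdx i $ unIdx j)"
proof -
  have "unrelabel (axis j 1) = axis (unIdx j) (1::real)" for j :: "'n idx"
    by (auto simp: unrelabel_def axis_def vec_eq_iff idx.expand)
  then show ?thesis
    by (simp add: matrix_def relabel_def)
qed

lemma
  fixes F :: "'a::euclidean_space \<Rightarrow> 'b::euclidean_space"
  assumes "\<And>y. y \<notin> S \<Longrightarrow> F y = 0"
  shows absolutely_integrable_zero_outside: "F absolutely_integrable_on UNIV \<longleftrightarrow> F absolutely_integrable_on S"
    and has_integral_zero_outside: "(F has_integral i) UNIV \<longleftrightarrow> (F has_integral i) S"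
proof -
  have eq: "(\<lambda>x. if x \<in> S then F x else 0) = F" using assms by auto
  show "F absolutely_integrable_on UNIV \<longleftrightarrow> F absolutely_integrable_on S"
    using absolutely_integrable_restrict_UNIV[of S F] unfolding eq .
  show "(F has_integral i) UNIV \<longleftrightarrow> (F has_integral i) S"
    using has_integral_restrict_UNIV[of S F i] unfolding eq .
qed

context smooth_diffeo
begin

text \<open>The substitution is \<open>x = \<theta> y\<close>. Continuity is known for
  \<open>G\<close> only; integrability of \<open>X\<close> is an outcome, because the change of
  variables theorem transfers absolute integrability from the \<open>y\<close> side. The common box
  gives absolute integrability of \<open>G\<close> and lets the integrals be relabelled.\<close>

lemma change_of_variables:
  fixes X G :: "real^'n \<Rightarrow> complex"
  assumes contG: "continuous_on (cbox a b) G"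
    and zero: "\<And>y. y \<notin> cbox a b \<Longrightarrow> G y = 0" "\<And>x. x \<notin> cbox a b \<Longrightarrow> X x = 0"
      "\<And>y. y \<notin> \<Omega> \<Longrightarrow> G y = 0" "\<And>x. x \<notin> \<Omega>' \<Longrightarrow> X x = 0"
    and GX: "\<And>y. y \<in> \<Omega> \<Longrightarrow> G y = of_real (jac y) * X (\<theta> y)"
  shows "integral UNIV X = integral UNIV G"
proof -
  \<comment> \<open>The change of variables theorem concerns vector-valued functions, so complex
    values travel as elements of \<open>real^2\<close>: \<open>h\<close> goes there and
    \<open>k\<close> comes back.\<close>
  define h :: "complex \<Rightarrow> real^2" where "h z = vector [Re z, Im z]" for z
  define k :: "real^2 \<Rightarrow> complex" where "k v = Complex (v $ 1) (v $ 2)" for v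
  have kh: "k (h z) = z" for z by (simp add: h_def k_def)
  have blh: "bounded_linear h"
    by (rule linear_conv_bounded_linear[THEN iffD1], rule linearI)
      (simp_all add: h_def vec_eq_iff forall_2)
  have blk: "bounded_linear k"
    by (rule linear_conv_bounded_linear[THEN iffD1], rule linearI)
      (simp_all add: k_def complex_eq_iff)
  let ?S = "unrelabel -` \<Omega>" and ?S' = "unrelabel -` \<Omega>'"
  let ?B = "cbox (relabel a) (relabel b)"
  define g where "g = relabel \<circ> \<theta> \<circ> unrelabel"
  define g' where "g' y = relabel \<circ> frechet_derivative \<theta> (at (unrelabel y)) \<circ> unrelabel" for y
  define f where "f x = h (X (unrelabel x))" for x
  have S: "open ?S"
    by (rule open_vimage[OF open_\<Omega> linear_continuous_on[OF bounded_linear_relabel(2)]])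
  have der: "(g has_derivative g' y) (at y within ?S)" if y: "y \<in> ?S" for y
  proof -
    have "(\<theta> has_derivative frechet_derivative \<theta> (at (unrelabel y))) (at (unrelabel y))"
      using smooth_on_differentiable[OF smooth_\<theta>] y frechet_derivative_works by blast
    then have "(g has_derivative g' y) (at y)"
      unfolding g_def g'_def
      by (intro diff_chain_at bounded_linear_imp_has_derivative bounded_linear_relabel)
    then show ?thesis by (rule has_derivative_at_withinI)
  qed
  have inj: "inj_on g ?S"
  proof (rule inj_onI)
    fix x y assume "x \<in> ?S" "y \<in> ?S" "g x = g y"
    then have "\<psi> (\<theta> (unrelabel x)) = \<psi> (\<theta> (unrelabel y))"
      unfolding g_def by (metis comp_apply relabel_unrelabel(2))
    then show "x = y" using \<open>x \<in> ?S\<close> \<open>y \<in> ?S\<close> \<psi>_\<theta> by (metis relabel_unrelabel(1) vimageE)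
  qed
  have img: "g ` ?S = ?S'"
  proof
    show "g ` ?S \<subseteq> ?S'" using \<theta>_image by (auto simp: g_def)
    show "?S' \<subseteq> g ` ?S"
    proof
      fix x assume x: "x \<in> ?S'"
      have "x = g (relabel (\<psi> (unrelabel x)))" using x \<theta>_\<psi> by (simp add: g_def)
      moreover have "relabel (\<psi> (unrelabel x)) \<in> ?S" using x \<psi>_image by auto
      ultimately show "x \<in> g ` ?S" by blast
    qed
  qed
  have fg: "\<bar>det (matrix (g' y))\<bar> *\<^sub>R f (g y) = h (G (unrelabel y))" if "y \<in> ?S" for y
  proof -
    have "\<bar>det (matrix (g' y))\<bar> = jac (unrelabel y)"
      unfolding g'_def matrix_relabel det_relabel jac_def ..
    then show ?thesis
      using that GX[of "unrelabel y"] linear_cmul[OF bounded_linear.linear[OF blh]]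
      by (simp add: f_def g_def scaleR_conv_of_real[symmetric])
  qed
  have h0: "h 0 = 0" using linear_0[OF bounded_linear.linear[OF blh]] .
  have out: "unrelabel y \<notin> cbox a b" if "y \<notin> ?B" for y
    using that relabel_cbox(1)[of a b] by (metis image_eqI relabel_unrelabel(1))
  have zB: "h (G (unrelabel y)) = 0" if "y \<notin> ?B" for y
    using zero(1)[OF out[OF that]] h0 by simp
  have absG: "(\<lambda>y. h (G (unrelabel y))) absolutely_integrable_on UNIV"
  proof -
    have "continuous_on ?B (\<lambda>y. G (unrelabel y))"
      by (rule continuous_on_compose2[OF contG linear_continuous_on[OF bounded_linear_relabel(2)]])
        (use relabel_cbox(2)[of "relabel a" "relabel b"] in simp)
    then have "continuous_on ?B (\<lambda>y. h (G (unrelabel y)))"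
      by (rule continuous_on_compose2[OF linear_continuous_on[OF blh, of UNIV]]) simp
    then have "(\<lambda>y. h (G (unrelabel y))) absolutely_integrable_on ?B"
      by (rule absolutely_integrable_continuous)
    then show ?thesis
      by (subst absolutely_integrable_zero_outside[of ?B]) (simp_all add: zB)
  qed
  have zS: "h (G (unrelabel y)) = 0" if "y \<notin> ?S" for y
    using zero(3)[of "unrelabel y"] that h0 by simp
  have absS: "(\<lambda>y. h (G (unrelabel y))) absolutely_integrable_on ?S"
    using absG by (subst absolutely_integrable_zero_outside[of ?S, symmetric]) (simp_all add: zS)
  have "(\<lambda>y. \<bar>det (matrix (g' y))\<bar> *\<^sub>R f (g y)) absolutely_integrable_on ?S"
    by (subst set_integrable_cong[OF refl refl fg]) (simp_all add: absS)
  moreover have "integral ?S (\<lambda>y. \<bar>det (matrix (g' y))\<bar> *\<^sub>R f (g y)) = integral UNIV (\<lambda>y. h (G (unrelabel y)))"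
  proof -
    have "integral ?S (\<lambda>y. \<bar>det (matrix (g' y))\<bar> *\<^sub>R f (g y)) = integral ?S (\<lambda>y. h (G (unrelabel y)))"
      by (rule integral_cong) (rule fg)
    also have "\<dots> = integral UNIV (\<lambda>y. h (G (unrelabel y)))"
      by (rule integral_UNIV_eq[symmetric]) (rule zS)
    finally show ?thesis .
  qed
  ultimately have f: "f absolutely_integrable_on ?S'" "integral ?S' f = integral UNIV (\<lambda>y. h (G (unrelabel y)))"
    using has_absolute_integral_change_of_variables[OF _ der inj, of f] S img
    by (auto simp: lmeasurable_open borel_open)
  \<comment> \<open>\<open>f\<close> vanishes outside \<open>?S'\<close> and outside
    \<open>?B\<close>, so its integral over \<open>?S'\<close> is also its integral over the box,
    where relabelling can be undone.\<close>
  have hi: "(f has_integral integral UNIV (\<lambda>y. h (G (unrelabel y)))) ?B"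
  proof -
    have f0: "f x = 0" if "x \<notin> ?S'" for x
      using zero(4)[of "unrelabel x"] that h0 by (simp add: f_def)
    have f0': "f x = 0" if "x \<notin> ?B" for x
      using zero(2)[OF out[OF that]] h0 by (simp add: f_def)
    have "f integrable_on ?S'"
      using f(1) absolutely_integrable_on_def by blast
    then have "(f has_integral integral UNIV (\<lambda>y. h (G (unrelabel y)))) ?S'"
      using f(2) integrable_integral by metis
    then show ?thesis
      using has_integral_zero_outside[of ?S' f, OF f0] has_integral_zero_outside[of ?B f, OF f0'] by simp
  qed
  have G_int: "((\<lambda>y. G (unrelabel y)) has_integral integral (cbox a b) G) ?B"
    unfolding has_integral_relabel using integrable_continuous[OF contG] by (rule integrable_integral)
  have "integral UNIV (\<lambda>y. h (G (unrelabel y))) = integral ?B (\<lambda>y. h (G (unrelabel y)))"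
    by (rule integral_UNIV_eq) (rule zB)
  also have "\<dots> = h (integral (cbox a b) G)"
    using has_integral_linear[OF G_int blh] by (simp add: o_def integral_unique)
  finally have "((\<lambda>x. k (f x)) has_integral integral (cbox a b) G) ?B"
    using has_integral_linear[OF hi blk] by (simp add: o_def kh)
  then have "((\<lambda>x. X (unrelabel x)) has_integral integral (cbox a b) G) ?B"
    by (simp add: f_def kh)
  then have "integral (cbox a b) X = integral (cbox a b) G"
    unfolding has_integral_relabel by (rule integral_unique)
  then show ?thesis
    using integral_UNIV_eq[of "cbox a b" X] integral_UNIV_eq[of "cbox a b" G] zero by simp
qed

end

subsection \<open>Comparison of the two embeddings\<close>

lemma cball_subset_cbox:
  obtains a b :: "'a::euclidean_space" where "cball 0 r \<subseteq> cbox a b"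
proof -
  obtain a where "cball 0 r \<subseteq> cbox (-a) (a :: 'a)"
    using bounded_subset_cbox_symmetric[OF bounded_cball] by blast
  then show thesis by (rule that)
qed

lemma integral_reflect_shift:
  fixes g :: "'a::euclidean_space \<Rightarrow> 'b::banach"
  assumes g: "g integrable_on cbox a b" and zero: "\<And>x. x \<notin> cbox a b \<Longrightarrow> g x = 0"
  shows "integral UNIV (\<lambda>x. g (t - x)) = integral UNIV g"
proof -
  let ?I = "(\<lambda>x. t - x) ` cbox a b"
  have "((\<lambda>x. g (-1 *\<^sub>R x + t)) has_integral (1 / \<bar>- 1\<bar> ^ DIM('a)) *\<^sub>R integral (cbox a b) g)
      ((\<lambda>x. (1 / - 1) *\<^sub>R x + - ((1 / - 1) *\<^sub>R t)) ` cbox a b)"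
    by (rule has_integral_affinity) (use integrable_integral[OF g] in auto)
  then have "((\<lambda>x. g (t - x)) has_integral integral (cbox a b) g) ?I"
    by simp
  then have "integral ?I (\<lambda>x. g (t - x)) = integral (cbox a b) g"
    by (rule integral_unique)
  moreover have "integral UNIV (\<lambda>x. g (t - x)) = integral ?I (\<lambda>x. g (t - x))"
  proof (rule integral_UNIV_eq)
    fix x assume x: "x \<notin> ?I"
    have "t - x \<notin> cbox a b"
    proof
      assume "t - x \<in> cbox a b"
      then have "t - (t - x) \<in> ?I" by blast
      with x show False by simp
    qed
    then show "g (t - x) = 0" by (rule zero)
  qed
  ultimately show ?thesis
    using integral_UNIV_eq[of "cbox a b" g, OF zero] by simp
qed

text \<open>Both factors vanish outside the same box, so either integral extends to the whole space,
  where substituting \<open>t - x\<close> for \<open>x\<close> exchanges the factors.\<close>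

lemma conv_commute:
  fixes u v :: "real^'n \<Rightarrow> complex"
  assumes u: "continuous_on UNIV u" "\<And>x. x \<notin> cbox a b \<Longrightarrow> u x = 0"
    and v: "continuous_on UNIV v" "\<And>x. x \<notin> cbox a b \<Longrightarrow> v x = 0"
  shows "conv a b u v t = conv a b v u t"
proof -
  have "conv a b u v t = integral UNIV (\<lambda>x. u x * v (t - x))"
    by (rule integral_UNIV_eq[symmetric]) (simp add: u(2))
  also have "\<dots> = integral UNIV (\<lambda>x. u (t - x) * v (t - (t - x)))"
    by (rule integral_reflect_shift[OF integrable_conv[OF u(1) v(1), of t a b], symmetric]) (simp add: u(2))
  also have "\<dots> = integral UNIV (\<lambda>x. v x * u (t - x))"
    by (simp add: mult.commute)
  also have "\<dots> = conv a b v u t"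
    by (rule integral_UNIV_eq) (simp add: v(2))
  finally show ?thesis .
qed

lemma iterpd_bounded:
  fixes \<sigma> :: "real^'n \<Rightarrow> complex"
  assumes "test_fun \<Omega> \<sigma>"
  obtains M where "\<And>bs x. set bs \<subseteq> Basis \<Longrightarrow> length bs \<le> k \<Longrightarrow> norm (iterpd bs \<sigma> x) \<le> M"
proof -
  let ?L = "{bs :: (real^'n) list. set bs \<subseteq> Basis \<and> length bs \<le> k}"
  have \<sigma>: "smooth_on UNIV \<sigma>" "compact (tsupport \<sigma>)"
    using assms by (auto simp: test_fun_def)
  have "finite ?L" by (rule finite_lists_length_le) simp
  moreover have "bounded (iterpd bs \<sigma> ` tsupport \<sigma>)" if "bs \<in> ?L" for bs
    using that \<sigma> smooth_on_continuous[OF smooth_on_iterpd[OF \<sigma>(1), of bs]]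
    by (intro compact_imp_bounded compact_continuous_image) (auto intro: continuous_on_subset)
  ultimately have "bounded (\<Union>bs\<in>?L. iterpd bs \<sigma> ` tsupport \<sigma>)"
    by blast
  then obtain M where M0: "M > 0" and M: "\<forall>z\<in>(\<Union>bs\<in>?L. iterpd bs \<sigma> ` tsupport \<sigma>). norm z \<le> M"
    unfolding bounded_pos by (elim exE conjE)
  have "norm (iterpd bs \<sigma> x) \<le> M" if "set bs \<subseteq> Basis" "length bs \<le> k" for bs x
  proof (cases "x \<in> tsupport \<sigma>")
    case True
    then show ?thesis using that by (intro M[rule_format]) blast
  qed (use M0 in \<open>simp add: iterpd_outside_tsupport\<close>)
  then show thesis by (rule that)
qed

text \<open>The 5 splits as 2 + 3: a point within \<open>2 * Rphi \<phi>\<close> of \<open>x\<close>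
  keeps distance at least \<open>3 * Rphi \<phi>\<close> from the frontier, hence strictly more than
  the required \<open>2 * Rphi \<phi>\<close>. The last hypothesis provides
  \<open>norm z < 1 / Rphi \<phi>\<close>.\<close>

lemma cball_subset_Omega_tilde:
  assumes \<Omega>: "open \<Omega>" and \<epsilon>: "cball x \<epsilon> \<subseteq> \<Omega>" and R: "0 < Rphi \<phi>" "5 * Rphi \<phi> < \<epsilon>"
    and x: "(norm x + 2 * Rphi \<phi>) * Rphi \<phi> < 1"
  shows "cball x (2 * Rphi \<phi>) \<subseteq> Omega_tilde \<Omega> \<phi>"
proof
  let ?R = "Rphi \<phi>"
  fix z assume z: "z \<in> cball x (2 * ?R)"
  have "z \<in> \<Omega>" using z \<epsilon> R by auto
  moreover have "frontier \<Omega> = {} \<or> 2 * ?R < infdist z (frontier \<Omega>)"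
  proof (cases "frontier \<Omega> = {}")
    case False
    have "3 * ?R \<le> dist z w" if "w \<in> frontier \<Omega>" for w
    proof -
      have "w \<notin> \<Omega>" using that \<Omega> by (simp add: frontier_def interior_open)
      then have "w \<notin> cball x \<epsilon>" using \<epsilon> by blast
      then have "\<epsilon> < dist x w" by simp
      then show ?thesis
        using z R dist_triangle[of x w z] by simp
    qed
    then have "3 * ?R \<le> infdist z (frontier \<Omega>)"
      using False by (simp add: infdist_notempty cINF_greatest)
    then show ?thesis using R by simp
  qed simp
  moreover have "norm z < 1 / ?R"
  proof -
    have "norm z \<le> norm x + 2 * ?R"
      using z norm_triangle_ineq2[of z x] by (simp add: dist_norm norm_minus_commute)
    then have "norm z * ?R < 1"
      using x R by (meson mult_right_mono le_less_trans less_imp_le)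
    then show ?thesis using R by (simp add: field_simps)
  qed
  ultimately show "z \<in> Omega_tilde \<Omega> \<phi>" by (simp add: Omega_tilde_def)
qed

text \<open>As a function of \<open>s\<close>, \<open>\<phi> (t - s)\<close> lives in the ball of
  radius \<open>Rphi \<phi>\<close> about \<open>t\<close>, so integrating over
  \<open>Omega_tilde \<Omega> \<phi>\<close> already gives the full integral.\<close>

lemma C_fun_eq_1:
  assumes \<phi>: "test_fun UNIV \<phi>" and int1: "integral UNIV \<phi> = 1"
    and t: "cball t (Rphi \<phi>) \<subseteq> Omega_tilde \<Omega> \<phi>"
  shows "C_fun \<Omega> \<phi> t = 1"
proof -
  obtain a b :: "real^'a" where ab: "cball 0 (Rphi \<phi>) \<subseteq> cbox a b" by (rule cball_subset_cbox)
  have z: "\<phi> x = 0" if "x \<notin> cbox a b" for x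
    using test_fun_norm_le_Rphi[OF \<phi>, of x] that ab by (metis mem_cball_0 subsetD)
  have int: "\<phi> integrable_on cbox a b"
    using \<phi> smooth_on_continuous[of UNIV \<phi>] continuous_on_subset
    by (intro integrable_continuous) (auto simp: test_fun_def)
  have "integral UNIV (\<lambda>s. \<phi> (t - s)) = integral (Omega_tilde \<Omega> \<phi>) (\<lambda>s. \<phi> (t - s))"
  proof (rule integral_UNIV_eq, rule ccontr)
    fix s assume "s \<notin> Omega_tilde \<Omega> \<phi>" "\<phi> (t - s) \<noteq> 0"
    then have "s \<in> cball t (Rphi \<phi>)"
      using test_fun_norm_le_Rphi[OF \<phi>, of "t - s"] by (simp add: dist_norm)
    with t \<open>s \<notin> Omega_tilde \<Omega> \<phi>\<close> show False by blast
  qed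
  then show ?thesis
    using integral_reflect_shift[OF int z, of t] int1 by (simp add: C_fun_def)
qed

text \<open>This is applied twice, to \<open>T\<close> with \<open>push \<tau>\<close> and to the
  pullback with \<tau>; the bound \<open>Rphi \<phi> ^ p / 2\<close> lets the two errors add up.
  Continuity is exported because the change of variables asks for it.\<close>

lemma dconv_approx:
  fixes T :: "(real^'n::finite \<Rightarrow> complex) \<Rightarrow> complex"
  assumes T: "list_distribution \<Omega> T" and \<Omega>: "open \<Omega>" and \<sigma>: "test_fun \<Omega> \<sigma>"
  obtains N where "N \<ge> 1" "\<And>n \<phi> a b. n \<ge> N \<Longrightarrow> \<phi> \<in> Dn n \<Longrightarrow> continuous_on (cbox a b) (\<lambda>x. dconv \<Omega> T \<phi> x * \<sigma> x)"
    "\<And>n \<phi>. n \<ge> N \<Longrightarrow> \<phi> \<in> Dn n \<Longrightarrow>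
      norm (integral UNIV (\<lambda>x. dconv \<Omega> T \<phi> x * \<sigma> x) - T \<sigma>) < Rphi \<phi> ^ p / 2"
proof -
  let ?K0 = "tsupport \<sigma>"
  have K0: "compact ?K0" "?K0 \<subseteq> \<Omega>" and s\<sigma>: "smooth_on UNIV \<sigma>"
    using \<sigma> by (auto simp: test_fun_def)
  obtain \<epsilon> where \<epsilon>: "\<epsilon> > 0" "(\<Union>x\<in>?K0. cball x \<epsilon>) \<subseteq> \<Omega>"
    using compact_subset_open_imp_cball_epsilon_subset[OF K0(1) \<Omega> K0(2)] .
  obtain r where r: "r > 0" "\<And>x. x \<in> ?K0 \<Longrightarrow> norm x \<le> r"
    using compact_imp_bounded[OF K0(1)] unfolding bounded_pos by blast
  \<comment> \<open>The closed \<epsilon>-neighbourhood of the support of \<sigma> contains the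
    supports of all translates \<open>\<phi> (t - x)\<close> with \<open>x\<close> in that support,
    once the radius is below \<epsilon>.\<close>
  define K where "K = {x + y |x y. x \<in> ?K0 \<and> y \<in> cball 0 \<epsilon>}"
  have cK: "compact K"
    unfolding K_def by (intro compact_sums K0 compact_cball)
  have inK: "z \<in> K" if "x \<in> ?K0" "norm (z - x) \<le> \<epsilon>" for x z
    unfolding K_def using that by (intro CollectI exI[of _ x] exI[of _ "z - x"]) auto
  have K\<Omega>: "K \<subseteq> \<Omega>"
  proof
    fix z assume "z \<in> K"
    then obtain x y where "z = x + y" "x \<in> ?K0" "norm y \<le> \<epsilon>" unfolding K_def by auto
    then have "z \<in> cball x \<epsilon>" by (simp add: dist_norm)
    with \<open>x \<in> ?K0\<close> \<epsilon>(2) show "z \<in> \<Omega>" by blast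
  qed
  have t\<sigma>: "test_in K \<sigma>"
    using inK[of x x for x] \<epsilon>(1) by (intro test_fun_test_in[OF \<sigma>]) auto
  obtain C m where C: "C \<ge> 0" and Cm: "\<And>\<phi> B. test_fun \<Omega> \<phi> \<Longrightarrow> tsupport \<phi> \<subseteq> K \<Longrightarrow> 0 \<le> B \<Longrightarrow>
      (\<And>bs x. set bs \<subseteq> Basis \<Longrightarrow> length bs \<le> m \<Longrightarrow> x \<in> K \<Longrightarrow> norm (iterpd bs \<phi> x) \<le> B) \<Longrightarrow>
      norm (T \<phi>) \<le> C * B"
    using list_distribution_bound[OF T cK K\<Omega>] by blast
  \<comment> \<open>The extra power of the radius will absorb the constant
    \<open>2 * (C * D)\<close>.\<close>
  let ?q = "Suc p"
  obtain M where M: "\<And>bs x. set bs \<subseteq> Basis \<Longrightarrow> length bs \<le> m + ?q \<Longrightarrow> norm (iterpd bs \<sigma> x) \<le> M"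
    using iterpd_bounded[OF \<sigma>] by blast
  have M0: "0 \<le> M" using order_trans[OF norm_ge_zero M[of "[]"]] by simp
  define D where "D = 2 * (real (card (basis_lists ?q :: (real^'n) list set)) * M)"
  have D0: "0 \<le> D" using M0 by (simp add: D_def)
  \<comment> \<open>In order: the radius times \<open>2 * (C * D)\<close> is below 1; five radii
    stay below \<epsilon>; the condition \<open>norm z < 1 / Rphi \<phi>\<close> holds near the
    support, with 3 covering \<open>2 * Rphi \<phi>\<close>; and enough moments vanish for the
    Taylor order \<open>?q\<close>.\<close>
  obtain N :: nat where N: "real N > max (max (2 * (C * D)) (5 / \<epsilon>)) (max (r + 3) ?q)"
    using reals_Archimedean2 by blast
  have N1: "N \<ge> 1" using N by auto
  have main: "continuous_on (cbox a b) (\<lambda>x. dconv \<Omega> T \<phi> x * \<sigma> x)"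
    "norm (integral UNIV (\<lambda>x. dconv \<Omega> T \<phi> x * \<sigma> x) - T \<sigma>) < Rphi \<phi> ^ p / 2"
    if n: "n \<ge> N" and \<phi>: "\<phi> \<in> Dn n" for n \<phi> a b
  proof -
    let ?R = "Rphi \<phi>"
    have tf: "test_fun UNIV \<phi>" and int1: "integral UNIV \<phi> = 1" and even: "\<And>x. \<phi> (- x) = \<phi> x"
      and Rn: "?R \<le> 1 / real n"
      using \<phi> by (auto simp: Dn_def)
    have s\<phi>: "smooth_on UNIV \<phi>" using tf by (simp add: test_fun_def)
    have R: "0 < ?R" using Rphi_pos[OF tf] int1 by simp
    have "1 / real n \<le> 1 / real N" using n N1 by (simp add: frac_le)
    with Rn have "?R \<le> 1 / real N" by linarith
    then have RN: "?R * real N \<le> 1" using N1 by (simp add: field_simps)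
    have Rx: "?R * c < 1" if "c < real N" for c
      using mult_strict_left_mono[OF that R] RN by linarith
    have R1: "?R * (2 * (C * D)) < 1" "5 * ?R < \<epsilon>" "?R * (r + 3) < 1"
      using Rx[of "2 * (C * D)"] Rx[of "5 / \<epsilon>"] Rx[of "r + 3"] N \<epsilon>(1) by (auto simp: field_simps)
    have "?R * 3 < 1"
      using R1(3) mult_left_mono[of 3 "r + 3" ?R] R r(1) by linarith
    then have Rle1: "?R < 1" by simp
    have qn: "?q \<le> n" using N n by linarith
    have tilde: "cball x (2 * ?R) \<subseteq> Omega_tilde \<Omega> \<phi>" if "x \<in> ?K0" for x
    proof (rule cball_subset_Omega_tilde[OF \<Omega> _ R R1(2)])
      show "cball x \<epsilon> \<subseteq> \<Omega>" using \<epsilon>(2) that by blast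
      have "(norm x + 2 * ?R) * ?R \<le> (r + 3) * ?R"
        using r(2)[OF that] Rle1 R by (intro mult_right_mono) auto
      then show "(norm x + 2 * ?R) * ?R < 1" using R1(3) by (simp add: mult.commute)
    qed
    have C1: "C_fun \<Omega> \<phi> t * \<phi> (x - t) = \<phi> (t - x)" if "x \<in> ?K0" for x t
    proof (cases "\<phi> (x - t) = 0")
      case True
      then show ?thesis using even[of "x - t"] by simp
    next
      case False
      then have "norm (x - t) \<le> ?R" by (rule test_fun_norm_le_Rphi[OF tf])
      \<comment> \<open>Where \<open>\<phi> (x - t)\<close> is nonzero, \<open>t\<close> lies within
        one radius of \<open>x\<close>; this is why \<open>tilde\<close> provides balls of twice the
        radius.\<close>
      then have "cball t ?R \<subseteq> cball x (2 * ?R)"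
        by (simp add: subset_cball dist_norm[symmetric] cball_subset_cball_iff dist_commute)
      then have "C_fun \<Omega> \<phi> t = 1"
        using tilde[OF that] by (intro C_fun_eq_1 tf int1) blast
      then show ?thesis using even[of "x - t"] by simp
    qed
    have tr: "test_in K (\<lambda>t. \<phi> (t - x))" if "x \<in> ?K0" for x
    proof -
      have "\<phi> (t - x) = 0" if "t \<notin> K" for t
        using test_fun_norm_le_Rphi[OF tf, of "t - x"] inK[OF \<open>x \<in> ?K0\<close>, of t] that R1(2) R by force
      then show ?thesis using smooth_translate[OF s\<phi>] by (simp add: test_in_def)
    qed
    have F: "dconv \<Omega> T \<phi> x * \<sigma> x = T (\<lambda>t. \<sigma> x * \<phi> (t - x))" for x
    proof (cases "x \<in> ?K0")
      case True
      then show ?thesis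
        using distr_cmult[OF T cK K\<Omega> tr[OF True], of "\<sigma> x"] by (simp add: dconv_def C1)
    next
      case False
      then have "\<sigma> x = 0" by (rule tsupport_outside)
      then show ?thesis using distr_zero[OF T cK K\<Omega>] by simp
    qed
    have supp: "\<sigma> x * \<phi> (t - x) = 0" if "t \<notin> K" for x t
    proof (cases "x \<in> ?K0")
      case True
      then show ?thesis using tr that by (simp add: test_in_def)
    qed (simp add: tsupport_outside)
    have conv: "continuous_on (cbox a b) (\<lambda>x. dconv \<Omega> T \<phi> x * \<sigma> x)"
      "T (conv a b \<sigma> \<phi>) = integral (cbox a b) (\<lambda>x. dconv \<Omega> T \<phi> x * \<sigma> x)" for a b
      unfolding F by (rule distr_conv[OF T cK K\<Omega> smooth_on_continuous[OF s\<sigma>] s\<phi> supp], assumption)+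
    show "continuous_on (cbox a b) (\<lambda>x. dconv \<Omega> T \<phi> x * \<sigma> x)"
      by (rule conv(1))
    \<comment> \<open>The radius \<open>max r ?R\<close> makes both \<sigma> and \<phi> vanish
      outside the box, as commutativity requires.\<close>
    obtain a b :: "real^'n" where ab: "cball 0 (max r ?R) \<subseteq> cbox a b" by (rule cball_subset_cbox)
    have z\<sigma>: "\<sigma> x = 0" if "x \<notin> cbox a b" for x
    proof -
      have "x \<notin> ?K0" using r(2)[of x] ab that by (auto simp: subset_iff)
      then show ?thesis by (rule tsupport_outside)
    qed
    have z\<phi>: "\<phi> x = 0" if "x \<notin> cbox a b" for x
      using test_fun_norm_le_Rphi[OF tf, of x] ab that by (fastforce simp: subset_iff)
    have cc: "conv a b \<sigma> \<phi> = conv a b \<phi> \<sigma>"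
      by (rule ext, rule conv_commute) (use z\<sigma> z\<phi> smooth_on_continuous s\<sigma> s\<phi> in auto)
    have "integral UNIV (\<lambda>x. dconv \<Omega> T \<phi> x * \<sigma> x) = integral (cbox a b) (\<lambda>x. dconv \<Omega> T \<phi> x * \<sigma> x)"
      by (rule integral_UNIV_eq) (simp add: z\<sigma>)
    also have "\<dots> = T (conv a b \<phi> \<sigma>)"
      unfolding conv(2)[symmetric] cc ..
    finally have eq: "integral UNIV (\<lambda>x. dconv \<Omega> T \<phi> x * \<sigma> x) = T (conv a b \<phi> \<sigma>)" .
    have "conv a b \<phi> \<sigma> t = 0" if "t \<notin> K" for t
      using fun_cong[OF cc, of t] supp[OF that] by (simp only: integral_0)
    then have H: "test_in K (conv a b \<phi> \<sigma>)"
      using smooth_conv[OF smooth_on_continuous[OF s\<phi>] s\<sigma>] by (simp add: test_in_def)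
    have "norm (T (\<lambda>t. conv a b \<phi> \<sigma> t - \<sigma> t)) \<le> C * (D * ?R ^ ?q)"
    proof (rule Cm[OF test_in_test_fun[OF test_in_diff[OF H t\<sigma>] cK K\<Omega>]])
      fix bs :: "(real^'n) list" and t assume bs: "set bs \<subseteq> Basis" "length bs \<le> m"
      \<comment> \<open>After the exchange all derivatives fall on \<sigma>, so the moment estimate
        applies with \<open>iterpd bs \<sigma>\<close> in place of \<sigma>; hence the bounds up to
        order \<open>m + ?q\<close>.\<close>
      have "iterpd bs (\<lambda>t. conv a b \<phi> \<sigma> t - \<sigma> t) t = conv a b \<phi> (iterpd bs \<sigma>) t - iterpd bs \<sigma> t"
        using iterpd_diff[OF _ s\<sigma> bs(1), of "conv a b \<phi> \<sigma>" t] H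
          iterpd_conv[OF smooth_on_continuous[OF s\<phi>] s\<sigma> bs(1)] by (simp add: test_in_def)
      moreover have "norm (conv a b \<phi> (iterpd bs \<sigma>) t - iterpd bs \<sigma> t) \<le> D * ?R ^ ?q"
        unfolding D_def
      proof (rule conv_Dn_approx[OF \<phi> _ _ qn smooth_on_iterpd[OF s\<sigma> bs(1)]])
        show "norm (iterpd c (iterpd bs \<sigma>) x) \<le> M" if "c \<in> basis_lists ?q" for c x
          unfolding iterpd_append[symmetric] using that bs by (intro M) auto
      qed (use n N1 ab in auto)
      ultimately show "norm (iterpd bs (\<lambda>t. conv a b \<phi> \<sigma> t - \<sigma> t) t) \<le> D * ?R ^ ?q" by simp
    qed (use D0 R in simp)
    also have "\<dots> = (?R * (2 * (C * D))) * (?R ^ p / 2)" by simp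
    also have "\<dots> < 1 * (?R ^ p / 2)"
      using R1(1) R by (intro mult_strict_right_mono) auto
    finally show "norm (integral UNIV (\<lambda>x. dconv \<Omega> T \<phi> x * \<sigma> x) - T \<sigma>) < ?R ^ p / 2"
      unfolding eq distr_diff[OF T cK K\<Omega> H t\<sigma>, symmetric] by simp
  qed
  show thesis
    using N1 main by (rule that)
qed

theorem theorem5p5:
  fixes U :: "(real^'n::finite \<Rightarrow> complex) set set"
    and \<Omega> \<Omega>' :: "(real^'n) set"
    and T :: "(real^'n \<Rightarrow> complex) \<Rightarrow> complex"
    and \<psi> :: "real^'n \<Rightarrow> real^'n"
    and \<tau> :: "real^'n \<Rightarrow> complex"
  assumes "admissible_ultrafilter U"
    and "open \<Omega>" and "open \<Omega>'"
    and "distribution \<Omega> T"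
    and "diffeo \<Omega>' \<Omega> \<psi>"
    and "test_fun \<Omega>' \<tau>"
  shows "negligible_net U (\<lambda>\<phi>.
           integral UNIV (\<lambda>x. dconv \<Omega> T \<phi> (\<psi> x) * \<tau> x)
         - integral UNIV (\<lambda>x. dconv \<Omega>' (pullback \<Omega>' \<psi> T) \<phi> x * \<tau> x))"
  unfolding negligible_net_def
proof
  fix p :: nat
  interpret smooth_diffeo \<Omega> \<Omega>' \<psi>
    using assms by unfold_locales
  let ?T' = "pullback \<Omega>' \<psi> T" and ?\<sigma> = "push \<tau>"
  have T: "list_distribution \<Omega> T"
    by (rule distribution_list_distribution) fact
  have T': "list_distribution \<Omega>' ?T'"
    by (rule list_distribution_pullback[OF T])
  note \<sigma> = test_fun_push[OF \<open>test_fun \<Omega>' \<tau>\<close>]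
  obtain N where N: "N \<ge> 1" "\<And>n \<phi> a b. n \<ge> N \<Longrightarrow> \<phi> \<in> Dn n \<Longrightarrow> continuous_on (cbox a b) (\<lambda>x. dconv \<Omega> T \<phi> x * ?\<sigma> x)"
    "\<And>n \<phi>. n \<ge> N \<Longrightarrow> \<phi> \<in> Dn n \<Longrightarrow>
      norm (integral UNIV (\<lambda>x. dconv \<Omega> T \<phi> x * ?\<sigma> x) - T ?\<sigma>) < Rphi \<phi> ^ p / 2"
    using dconv_approx[OF T \<open>open \<Omega>\<close> \<sigma>(1), where p=p] by blast
  obtain N' where N': "N' \<ge> 1" "\<And>n \<phi> a b. n \<ge> N' \<Longrightarrow> \<phi> \<in> Dn n \<Longrightarrow> continuous_on (cbox a b) (\<lambda>x. dconv \<Omega>' ?T' \<phi> x * \<tau> x)"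
    "\<And>n \<phi>. n \<ge> N' \<Longrightarrow> \<phi> \<in> Dn n \<Longrightarrow>
      norm (integral UNIV (\<lambda>x. dconv \<Omega>' ?T' \<phi> x * \<tau> x) - ?T' \<tau>) < Rphi \<phi> ^ p / 2"
    using dconv_approx[OF T' \<open>open \<Omega>'\<close> \<open>test_fun \<Omega>' \<tau>\<close>, where p=p] by blast
  \<comment> \<open>Both estimates hold for thresholds at most \<open>n\<close>, so a single
    \<open>Dn ?n\<close> serves both pairings.\<close>
  let ?n = "max N N'"
  let ?A = "\<lambda>\<phi>. integral UNIV (\<lambda>x. dconv \<Omega> T \<phi> (\<psi> x) * \<tau> x) - integral UNIV (\<lambda>x. dconv \<Omega>' ?T' \<phi> x * \<tau> x)"
  have "norm (?A \<phi>) < Rphi \<phi> ^ p" if \<phi>: "\<phi> \<in> Dn ?n" for \<phi>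
  proof -
    \<comment> \<open>The change of variables works with one box on both sides, so it has to contain
      both supports.\<close>
    have "compact (tsupport \<tau> \<union> tsupport ?\<sigma>)"
      using \<open>test_fun \<Omega>' \<tau>\<close> \<sigma>(1) by (auto simp: test_fun_def)
    then obtain a where a: "tsupport \<tau> \<union> tsupport ?\<sigma> \<subseteq> cbox (- a) a"
      using bounded_subset_cbox_symmetric compact_imp_bounded by blast
    have "integral UNIV (\<lambda>x. dconv \<Omega> T \<phi> (\<psi> x) * \<tau> x) = integral UNIV (\<lambda>x. dconv \<Omega> T \<phi> x * ?\<sigma> x)"
    proof (rule change_of_variables)
      show "continuous_on (cbox (- a) a) (\<lambda>x. dconv \<Omega> T \<phi> x * ?\<sigma> x)"
        using \<phi> by (intro N(2)[of ?n]) auto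
      show "dconv \<Omega> T \<phi> y * ?\<sigma> y = 0" if "y \<notin> cbox (- a) a" for y
        using tsupport_outside[of y ?\<sigma>] a that by auto
      show "dconv \<Omega> T \<phi> (\<psi> x) * \<tau> x = 0" if "x \<notin> cbox (- a) a" for x
        using tsupport_outside[of x \<tau>] a that by auto
      show "dconv \<Omega> T \<phi> y * ?\<sigma> y = 0" if "y \<notin> \<Omega>" for y
        using that by (simp add: push_def)
      show "dconv \<Omega> T \<phi> (\<psi> x) * \<tau> x = 0" if "x \<notin> \<Omega>'" for x
        using tsupport_outside[of x \<tau>] \<open>test_fun \<Omega>' \<tau>\<close> that by (auto simp: test_fun_def)
      show "dconv \<Omega> T \<phi> y * ?\<sigma> y = of_real (jac y) * (dconv \<Omega> T \<phi> (\<psi> (\<theta> y)) * \<tau> (\<theta> y))" if "y \<in> \<Omega>" for y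
        using that by (simp add: push_def \<psi>_\<theta>)
    qed
    then have "?A \<phi> = (integral UNIV (\<lambda>x. dconv \<Omega> T \<phi> x * ?\<sigma> x) - T ?\<sigma>)
        - (integral UNIV (\<lambda>x. dconv \<Omega>' ?T' \<phi> x * \<tau> x) - ?T' \<tau>)"
      by (simp add: pullback_push)
    moreover have "norm (integral UNIV (\<lambda>x. dconv \<Omega> T \<phi> x * ?\<sigma> x) - T ?\<sigma>) < Rphi \<phi> ^ p / 2"
      using \<phi> by (intro N(3)[of ?n]) auto
    moreover have "norm (integral UNIV (\<lambda>x. dconv \<Omega>' ?T' \<phi> x * \<tau> x) - ?T' \<tau>) < Rphi \<phi> ^ p / 2"
      using \<phi> by (intro N'(3)[of ?n]) auto
    ultimately show ?thesis
      using norm_triangle_ineq4 by (smt (verit) field_sum_of_halves)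
  qed
  \<comment> \<open>\<open>Dn ?n\<close> belongs to \<open>U\<close> and \<open>U\<close> is closed
    under supersets in \<open>D0\<close>, so the inclusion is all that remains.\<close>
  then have "Dn ?n \<subseteq> {\<phi> \<in> D0. norm (?A \<phi>) < Rphi \<phi> ^ p}"
    by (auto simp: Dn_def D0_def)
  moreover have "Dn ?n \<in> U"
    using assms(1) N(1) by (auto simp: admissible_ultrafilter_def)
  ultimately show "ae_U U (\<lambda>\<phi>. norm (?A \<phi>) < Rphi \<phi> ^ p)"
    using assms(1) unfolding ae_U_def admissible_ultrafilter_def free_ultrafilter_on_def ultrafilter_on_def
    by (metis (no_types, lifting) mem_Collect_eq subsetI)
qed

end
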